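(* Let $R>0$, $\Omega=(-R,R)$, $a\in L^\infty(\Omega)$ with $1/a\in L^\infty(\Omega)$, $b,c,f\in L^2(\Omega)$, $g_1,g_2,g\in L^2(\partial\Omega)$, and let $u^*\in H^2(\Omega)$ be a solution of $$Lu:=au''+bu'+cu=f\ \text{ in }\Omega,\qquad Bu:=g_1u'+g_2u=g\ \text{ on }\partial\Omega=\{-R,R\}.$$ Let $V_{RF}\subset H^2(\Omega)$ be a random feature trial space, let $\gamma>0$, and let $u_{RF}^*$ be a minimizer over $V_{RF}$ of $$\mathcal L(u)=\|Lu-f\|_{L^2(\Omega)}^2+\gamma\|Bu-g\|_{L^2(\partial\Omega)}^2 .$$ Let $V:=\{v\in H^2(\Omega):Lv=0\text{ in }\Omega,\ Bv=0\text{ on }\partial\Omega\}$. Then there is a constant $C$ independent of $u^*$ and $u_{RF}^*$ such that $$\inf_{v\in V}\|u^*+v-u_{RF}^*\|_{H^2(\Omega)}\le C\inf_{w\in V_{RF}}\|u^*-w\|_{H^2(\Omega)} .$$ In particular, if the solution is unique, then $\|u_{RF}^*-u^*\|_{H^2(\Omega)}\le C\inf_{w\in V_{RF}}\|w-u^*\|_{H^2(\Omega)}$.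
   Context: A random feature trial space is, for a given realization of the real hidden weights, either $\operatorname{span}\{\cos(k_i\cdot),\sin(k_i\cdot):1\le i\le N\}$, or the span of the functions $\phi_j(x)\cos(k_{j,q}(x-x_j))$, $\phi_j(x)\sin(k_{j,q}(x-x_j))$, $1\le j\le J$, $1\le q\le N_j$, where $\{\phi_j\}$ is a partition of unity on $\Omega$ by $W^{2,\infty}(\Omega)$ functions and $x_j$ is the center of the open interval $(\operatorname{supp}\phi_j)^\circ$. $L^2(\partial\Omega)$ is the space of functions on the two-point set $\{-R,R\}$ with $\|h\|^2=|h(-R)|^2+|h(R)|^2$. *)

theory Defs
  imports "HOL-Analysis.Analysis"
begin

text \<open>Functions on \<open>(-R,R)\<close> are represented by total functions on the reals; their
  values outside the interval are irrelevant, and elements of the Lebesgue and Sobolev spaces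
  are identified when they agree almost everywhere on it. All functions are real valued.\<close>

abbreviation Om :: "real \<Rightarrow> real set" where
  "Om R \<equiv> {-R<..<R}"

definition L2 :: "real \<Rightarrow> (real \<Rightarrow> real) set" where
  "L2 R = {u \<in> borel_measurable (lebesgue_on (Om R)).
             integrable (lebesgue_on (Om R)) (\<lambda>x. (u x)\<^sup>2)}"

definition L2_norm :: "real \<Rightarrow> (real \<Rightarrow> real) \<Rightarrow> real" where
  "L2_norm R u = sqrt (LINT x|lebesgue_on (Om R). (u x)\<^sup>2)"

definition Linf :: "real \<Rightarrow> (real \<Rightarrow> real) set" where
  "Linf R = {u \<in> borel_measurable (lebesgue_on (Om R)).
               \<exists>M. AE x in lebesgue_on (Om R). \<bar>u x\<bar> \<le> M}"

definition bd_norm :: "real \<Rightarrow> (real \<Rightarrow> real) \<Rightarrow> real" where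
  "bd_norm R h = sqrt (\<bar>h (-R)\<bar>\<^sup>2 + \<bar>h R\<bar>\<^sup>2)"

text \<open>The space $C_c^\infty(-R,R)$.\<close>

definition test_function :: "real \<Rightarrow> (real \<Rightarrow> real) \<Rightarrow> bool" where
  "test_function R \<psi> \<longleftrightarrow>
     (\<forall>n x. ((deriv ^^ n) \<psi>) differentiable (at x)) \<and> closure {x. \<psi> x \<noteq> 0} \<subseteq> Om R"

definition locally_integrable :: "real \<Rightarrow> (real \<Rightarrow> real) \<Rightarrow> bool" where
  "locally_integrable R u \<longleftrightarrow>
     (\<forall>K. compact K \<and> K \<subseteq> Om R \<longrightarrow> u absolutely_integrable_on K)"

definition has_weak_deriv :: "real \<Rightarrow> (real \<Rightarrow> real) \<Rightarrow> (real \<Rightarrow> real) \<Rightarrow> bool" where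
  "has_weak_deriv R u v \<longleftrightarrow> locally_integrable R u \<and> locally_integrable R v \<and>
     (\<forall>\<psi>. test_function R \<psi> \<longrightarrow>
        (LINT x|lebesgue_on (Om R). u x * deriv \<psi> x) =
        - (LINT x|lebesgue_on (Om R). v x * \<psi> x))"

text \<open>The weak derivative is determined only almost everywhere; an arbitrary representative is
  chosen.\<close>

definition wderiv :: "real \<Rightarrow> (real \<Rightarrow> real) \<Rightarrow> real \<Rightarrow> real" where
  "wderiv R u = (SOME v. has_weak_deriv R u v)"

text \<open>Functions that lie in \<open>X\<close> together with their weak derivatives up to order two.\<close>

definition W2 :: "real \<Rightarrow> (real \<Rightarrow> real) set \<Rightarrow> (real \<Rightarrow> real) set" where
  "W2 R X = {u \<in> X. \<exists>v\<in>X. \<exists>w\<in>X. has_weak_deriv R u v \<and> has_weak_deriv R v w}"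

definition H2 :: "real \<Rightarrow> (real \<Rightarrow> real) set" where
  "H2 R = W2 R (L2 R)"

definition W2inf :: "real \<Rightarrow> (real \<Rightarrow> real) set" where
  "W2inf R = W2 R (Linf R)"

definition H2_norm :: "real \<Rightarrow> (real \<Rightarrow> real) \<Rightarrow> real" where
  "H2_norm R u = sqrt ((L2_norm R u)\<^sup>2 + (L2_norm R (wderiv R u))\<^sup>2
                        + (L2_norm R (wderiv R (wderiv R u)))\<^sup>2)"

text \<open>Boundary values are those of the representative that is continuous up to the boundary.
  For \<open>u\<close> in \<open>H2 R\<close> such a representative exists for \<open>u\<close> and for its weak derivative, and it
  is unique on \<open>{-R..R}\<close>.\<close>

definition trace :: "real \<Rightarrow> (real \<Rightarrow> real) \<Rightarrow> real \<Rightarrow> real" where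
  "trace R u = (SOME v. continuous_on {-R..R} v \<and> (AE x in lebesgue_on (Om R). v x = u x))"

definition Lop :: "real \<Rightarrow> (real \<Rightarrow> real) \<Rightarrow> (real \<Rightarrow> real) \<Rightarrow> (real \<Rightarrow> real)
    \<Rightarrow> (real \<Rightarrow> real) \<Rightarrow> real \<Rightarrow> real" where
  "Lop R a b c u = (\<lambda>x. a x * wderiv R (wderiv R u) x + b x * wderiv R u x + c x * u x)"

definition Bop :: "real \<Rightarrow> (real \<Rightarrow> real) \<Rightarrow> (real \<Rightarrow> real)
    \<Rightarrow> (real \<Rightarrow> real) \<Rightarrow> real \<Rightarrow> real" where
  "Bop R g1 g2 u = (\<lambda>p. g1 p * trace R (wderiv R u) p + g2 p * trace R u p)"

definition bvp_solution :: "real \<Rightarrow> (real \<Rightarrow> real) \<Rightarrow> (real \<Rightarrow> real) \<Rightarrow> (real \<Rightarrow> real)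
    \<Rightarrow> (real \<Rightarrow> real) \<Rightarrow> (real \<Rightarrow> real) \<Rightarrow> (real \<Rightarrow> real) \<Rightarrow> (real \<Rightarrow> real)
    \<Rightarrow> (real \<Rightarrow> real) \<Rightarrow> bool" where
  "bvp_solution R a b c g1 g2 f g u \<longleftrightarrow> u \<in> H2 R \<and>
     (AE x in lebesgue_on (Om R). Lop R a b c u x = f x) \<and>
     (\<forall>p\<in>{-R, R}. Bop R g1 g2 u p = g p)"

definition bvp_kernel :: "real \<Rightarrow> (real \<Rightarrow> real) \<Rightarrow> (real \<Rightarrow> real) \<Rightarrow> (real \<Rightarrow> real)
    \<Rightarrow> (real \<Rightarrow> real) \<Rightarrow> (real \<Rightarrow> real) \<Rightarrow> (real \<Rightarrow> real) set" where
  "bvp_kernel R a b c g1 g2 = {v. bvp_solution R a b c g1 g2 (\<lambda>_. 0) (\<lambda>_. 0) v}"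

definition loss :: "real \<Rightarrow> real \<Rightarrow> (real \<Rightarrow> real) \<Rightarrow> (real \<Rightarrow> real) \<Rightarrow> (real \<Rightarrow> real)
    \<Rightarrow> (real \<Rightarrow> real) \<Rightarrow> (real \<Rightarrow> real) \<Rightarrow> (real \<Rightarrow> real) \<Rightarrow> (real \<Rightarrow> real)
    \<Rightarrow> (real \<Rightarrow> real) \<Rightarrow> real" where
  "loss R \<gamma> a b c g1 g2 f g u =
     (L2_norm R (\<lambda>x. Lop R a b c u x - f x))\<^sup>2
       + \<gamma> * (bd_norm R (\<lambda>p. Bop R g1 g2 u p - g p))\<^sup>2"

definition global_features :: "nat \<Rightarrow> (nat \<Rightarrow> real) \<Rightarrow> (real \<Rightarrow> real) set" where
  "global_features N k =
     {(\<lambda>x. \<Sum>i=1..N. \<alpha> i * cos (k i * x) + \<beta> i * sin (k i * x)) | \<alpha> \<beta>. True}"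

definition local_features :: "nat \<Rightarrow> (nat \<Rightarrow> nat) \<Rightarrow> (nat \<Rightarrow> real \<Rightarrow> real) \<Rightarrow> (nat \<Rightarrow> real)
    \<Rightarrow> (nat \<Rightarrow> nat \<Rightarrow> real) \<Rightarrow> (real \<Rightarrow> real) set" where
  "local_features J N \<phi> xc k =
     {(\<lambda>x. \<Sum>j=1..J. \<Sum>q=1..N j.
          \<alpha> j q * (\<phi> j x * cos (k j q * (x - xc j)))
        + \<beta> j q * (\<phi> j x * sin (k j q * (x - xc j)))) | \<alpha> \<beta>. True}"

text \<open>Each \<open>\<phi> j\<close> is taken to be the continuous representative of its class, so that its
  support is well defined.\<close>

definition partition_of_unity :: "real \<Rightarrow> nat \<Rightarrow> (nat \<Rightarrow> real \<Rightarrow> real) \<Rightarrow> bool" where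
  "partition_of_unity R J \<phi> \<longleftrightarrow>
     (\<forall>j\<in>{1..J}. \<phi> j \<in> W2inf R \<and> continuous_on (Om R) (\<phi> j) \<and> (\<forall>x\<in>Om R. 0 \<le> \<phi> j x)) \<and>
     (\<forall>x\<in>Om R. (\<Sum>j=1..J. \<phi> j x) = 1)"

definition support_center :: "real \<Rightarrow> (real \<Rightarrow> real) \<Rightarrow> real \<Rightarrow> bool" where
  "support_center R \<psi> z \<longleftrightarrow>
     (\<exists>l r. l < r \<and> interior (closure {x \<in> Om R. \<psi> x \<noteq> 0}) = {l<..<r} \<and> z = (l + r) / 2)"

text \<open>The weights \<open>k\<close> stand for one realization of the random hidden weights.\<close>

definition rf_trial_space :: "real \<Rightarrow> (real \<Rightarrow> real) set \<Rightarrow> bool" where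
  "rf_trial_space R U \<longleftrightarrow>
     (\<exists>N k. U = global_features N k) \<or>
     (\<exists>J N \<phi> xc k. partition_of_unity R J \<phi> \<and> (\<forall>j\<in>{1..J}. support_center R (\<phi> j) (xc j)) \<and>
        U = local_features J N \<phi> xc k)"

end

theory Submission
  imports Defs "HOL-Complex_Analysis.Great_Picard" "HOL-Real_Asymp.Real_Asymp"
begin

text \<open>Since \<open>u\<close> solves the problem, the loss of \<open>w\<close> is
  \<open>E (u - w)\<close> with \<open>E v = \<parallel>L v\<parallel>\<^sup>2 + \<gamma> \<parallel>B v\<parallel>\<^sup>2\<close>. So it suffices that
  \<open>dist(v, V)\<^sup>2 \<le> C E v\<close> and \<open>E v \<le> C \<parallel>v\<parallel>\<^sup>2\<close>; neither linearity nor the particular form of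
  the trial space matters. The second bound is the embedding of \<open>H\<^sup>2\<close> into \<open>C\<^sup>1\<close>. If the first one
  failed, there would be a bounded sequence at distance \<open>1\<close> from \<open>V\<close> along which \<open>E\<close> tends to
  \<open>0\<close>. By Arzela--Ascoli a subsequence converges in \<open>C\<^sup>1\<close>; dividing \<open>L v\<close> by \<open>a\<close> shows that the second
  derivatives converge in \<open>L\<^sup>2\<close> as well, so the limit lies in \<open>V\<close>, a contradiction.\<close>

section \<open>Smooth bump functions\<close>

text \<open>The coefficients \<open>b\<close> and \<open>c\<close> are only square integrable, so b
  u' and c u are controlled solely through the suprema of u' and u; this is why compactness is
  sought in C^1. In dimension one it is cheap: a primitive of an L^2 function is Hoelder continuous
  of exponent 1/2, with the L^2 norm as constant. The obstacle is the encoding.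
  \<open>wderiv\<close> is an arbitrary choice among representatives, so \<open>Lop\<close> is
  linear only almost everywhere, and \<open>trace\<close> is a choice as well. Every H^2 function is
  therefore replaced by a triple of a continuous function, its continuous derivative and an L^2
  second derivative, linked by integrals from -R. That these triples describe exactly H^2 rests on
  the du Bois-Reymond lemma, which calls for test functions and hence for smooth bumps. The
  contradiction argument uses that \<open>E\<close> is quadratically homogeneous and invariant under
  V: a violating function can be shifted by V and rescaled. The resulting constant is not explicit,
  but it is fixed before f, g, the solution and the trial space.\<close>

primrec diff_times :: "nat \<Rightarrow> (real \<Rightarrow> real) \<Rightarrow> bool" where
  "diff_times 0 f \<longleftrightarrow> (\<forall>x. f differentiable (at x))"
| "diff_times (Suc n) f \<longleftrightarrow> (\<forall>x. f differentiable (at x)) \<and> diff_times n (deriv f)"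

lemma diff_times_differentiable: "diff_times n f \<Longrightarrow> f differentiable (at x)"
  by (cases n) auto

text \<open>\<open>test_function\<close> speaks of the iterates \<open>deriv ^^ n\<close>, whereas
  closure under sums, products and affine substitution is proved by peeling off the first
  derivative; this equivalence joins the two.\<close>

lemma diff_times_iff:
  "diff_times n f \<longleftrightarrow> (\<forall>m\<le>n. \<forall>x. ((deriv ^^ m) f) differentiable (at x))"
proof (induction n arbitrary: f)
  case (Suc n)
  have "(\<forall>m\<le>Suc n. P m) \<longleftrightarrow> P 0 \<and> (\<forall>m\<le>n. P (Suc m))" for P :: "nat \<Rightarrow> bool"
    by (metis Suc_le_mono le0 not0_implies_Suc)
  then show ?case
    using Suc.IH[of "deriv f"] by (simp add: funpow_swap1)
qed auto

lemma diff_times_all_iff: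
  "(\<forall>n. diff_times n f) \<longleftrightarrow> (\<forall>n x. ((deriv ^^ n) f) differentiable (at x))"
  by (auto simp: diff_times_iff)

lemma diff_times_mono: "diff_times (Suc n) f \<Longrightarrow> diff_times n f"
  by (simp add: diff_times_iff)

text \<open>For \<open>flat\<close> the order cannot be raised one function at a time, since every
  derivative brings a new polynomial. An invariant set of functions treats the whole family at
  once.\<close>

lemma diff_times_coinduct:
  assumes "f \<in> S" and "\<And>f x. f \<in> S \<Longrightarrow> f differentiable (at x)"
    and "\<And>f. f \<in> S \<Longrightarrow> deriv f \<in> S"
  shows "diff_times n f"
  using assms(1) by (induction n arbitrary: f) (use assms in auto)

lemma differentiable_has_deriv:
  "f differentiable (at x) \<Longrightarrow> (f has_real_derivative deriv f x) (at x)" for f :: "real \<Rightarrow> real"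
  by (auto simp: DERIV_deriv_iff_real_differentiable)

lemma diff_times_add:
  "diff_times n f \<Longrightarrow> diff_times n g \<Longrightarrow> diff_times n (\<lambda>x. f x + g x)"
proof (induction n arbitrary: f g)
  case (Suc n)
  have "deriv (\<lambda>x. f x + g x) = (\<lambda>x. deriv f x + deriv g x)"
    using Suc.prems by (intro ext DERIV_imp_deriv DERIV_add differentiable_has_deriv) auto
  then show ?case using Suc by auto
qed auto

lemma diff_times_mult:
  "diff_times n f \<Longrightarrow> diff_times n g \<Longrightarrow> diff_times n (\<lambda>x. f x * g x)"
proof (induction n arbitrary: f g)
  case (Suc n)
  have "deriv (\<lambda>x. f x * g x) = (\<lambda>x. deriv f x * g x + f x * deriv g x)"
  proof
    fix x
    have "((\<lambda>x. f x * g x) has_real_derivative deriv f x * g x + deriv g x * f x) (at x)"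
      using Suc.prems by (intro DERIV_mult differentiable_has_deriv) auto
    then show "deriv (\<lambda>x. f x * g x) x = deriv f x * g x + f x * deriv g x"
      by (auto dest: DERIV_imp_deriv simp: mult.commute)
  qed
  moreover have "diff_times n f" "diff_times n g"
    using Suc.prems diff_times_mono by blast+
  ultimately show ?case using Suc by (auto intro!: diff_times_add)
qed auto

lemma diff_times_const: "diff_times n (\<lambda>x. k)"
  by (rule diff_times_coinduct[where S = "range (\<lambda>k x. k)"]) auto

lemma diff_times_affine:
  "diff_times n f \<Longrightarrow> diff_times n (\<lambda>x. f (r * x + s))"
proof (induction n arbitrary: f)
  case 0
  have "(f \<circ> (\<lambda>x. r * x + s)) differentiable (at x)" for x
    using 0 by (intro differentiable_chain_at) auto
  then show ?case by (simp add: o_def)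
next
  case (Suc n)
  have d: "((\<lambda>x. f (r * x + s)) has_real_derivative r * deriv f (r * x + s)) (at x)" for x
  proof -
    have "(f has_real_derivative deriv f (r * x + s)) (at (r * x + s))"
      using Suc.prems by (intro differentiable_has_deriv) auto
    moreover have "((\<lambda>x. r * x + s) has_real_derivative r) (at x)"
      by (auto intro!: derivative_eq_intros)
    ultimately have "((\<lambda>x. f (r * x + s)) has_real_derivative deriv f (r * x + s) * r) (at x)"
      by (rule DERIV_chain2)
    then show ?thesis by (simp add: mult.commute)
  qed
  have "deriv (\<lambda>x. f (r * x + s)) = (\<lambda>x. r * deriv f (r * x + s))"
    using d by (intro ext DERIV_imp_deriv) auto
  moreover have "diff_times n (\<lambda>x. r * deriv f (r * x + s))"
    using Suc by (intro diff_times_mult diff_times_const) simp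
  ultimately show ?case
    using d by (auto simp: real_differentiable_def)
qed

section \<open>The flat function exp(-1/x) and smooth bumps\<close>

definition flat :: "real poly \<Rightarrow> real \<Rightarrow> real" where
  "flat p x = (if x > 0 then poly p (1 / x) * exp (- 1 / x) else 0)"

lemma poly_times_exp_tendsto_0: "((\<lambda>s::real. poly p s * exp (- s)) \<longlongrightarrow> 0) at_top"
proof -
  have "((\<lambda>s. \<Sum>i\<le>degree p. coeff p i * (s ^ i / exp s)) \<longlongrightarrow> (\<Sum>i\<le>degree p. coeff p i * 0)) at_top"
    by (intro tendsto_intros tendsto_power_div_exp_0)
  then show ?thesis
    by (simp add: poly_altdef sum_divide_distrib exp_minus divide_inverse sum_distrib_right mult.assoc)
qed

text \<open>With s = 1/x, the chain rule multiplies the derivative (p' - p)(s) exp(-s) by ds/dx =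
  -s^2, and \<open>[:0, 0, 1:]\<close> is the polynomial s^2. So the family \<open>flat\<close> is
  closed under differentiation, also at the junction point 0.\<close>

lemma flat_deriv:
  "(flat p has_real_derivative flat ([:0, 0, 1:] * (p - pderiv p)) x) (at x)"
proof -
  consider "x < 0" | "x > 0" | "x = 0" by linarith
  then show ?thesis
  proof cases
    case 1
    have "((\<lambda>x. 0) has_real_derivative 0) (at x)" by simp
    then have "(flat p has_real_derivative 0) (at x)"
      by (rule DERIV_cong_ev[THEN iffD1, rotated -1])
         (use 1 in \<open>auto simp: flat_def eventually_nhds intro!: exI[of _ "{..<0}"]\<close>)
    then show ?thesis using 1 by (simp add: flat_def)
  next
    case 2
    have "((\<lambda>x. poly p (1 / x) * exp (- 1 / x)) has_real_derivative
        flat ([:0, 0, 1:] * (p - pderiv p)) x) (at x)"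
      using 2 by (auto intro!: derivative_eq_intros simp: flat_def field_simps power2_eq_square)
    then show ?thesis
      by (rule DERIV_cong_ev[THEN iffD1, rotated -1])
         (use 2 in \<open>auto simp: flat_def eventually_nhds intro!: exI[of _ "{0<..}"]\<close>)
  next
    case 3
    \<comment> \<open>For y = 1/s the quotient is s p(s) exp(-s), and \<open>pCons 0 p\<close> is
      the polynomial s p(s).\<close>
    have "((\<lambda>y. flat p y / y) \<longlongrightarrow> 0) (at_right 0)"
    proof -
      have "((\<lambda>y. poly (pCons 0 p) (inverse y) * exp (- inverse y)) \<longlongrightarrow> 0) (at_right (0::real))"
        by (rule filterlim_compose[OF poly_times_exp_tendsto_0 filterlim_inverse_at_top_right])
      then show ?thesis
        by (rule Lim_transform_eventually)
           (auto simp: flat_def field_simps eventually_at_right_less intro!: eventually_at_rightI[of 0 1])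
    qed
    moreover have "((\<lambda>y. flat p y / y) \<longlongrightarrow> 0) (at_left 0)"
      by (rule Lim_transform_eventually[OF tendsto_const])
         (auto simp: flat_def intro!: eventually_at_leftI[of "-1" 0])
    ultimately have "((\<lambda>y. flat p y / y) \<longlongrightarrow> 0) (at 0)"
      using filterlim_at_split by blast
    then show ?thesis
      using 3 by (simp add: DERIV_def flat_def)
  qed
qed

lemma diff_times_flat: "diff_times n (flat p)"
proof (rule diff_times_coinduct[where S = "range flat"])
  show "f differentiable (at x)" if "f \<in> range flat" for f x
    using that flat_deriv real_differentiable_def by blast
  show "deriv f \<in> range flat" if f: "f \<in> range flat" for f
  proof -
    obtain q where "f = flat q" using f by blast
    moreover have "deriv (flat q) = flat ([:0, 0, 1:] * (q - pderiv q))"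
      by (intro ext DERIV_imp_deriv flat_deriv)
    ultimately show ?thesis by auto
  qed
qed auto

text \<open>The parameter \<open>r\<close> is a steepness: for t > 0 the value
  \<open>flat 1 (r * t)\<close>, which is exp(-1/(r t)), tends to 1 as r grows. The bumps thus
  approximate the indicator of the open interval while staying between 0 and 1, as dominated
  convergence requires.\<close>

definition bump :: "real \<Rightarrow> real \<Rightarrow> real \<Rightarrow> real \<Rightarrow> real" where
  "bump r \<alpha> \<beta> x = flat 1 (r * (x - \<alpha>)) * flat 1 (r * (\<beta> - x))"

lemma diff_times_bump: "diff_times n (bump r \<alpha> \<beta>)"
proof -
  have "diff_times n (\<lambda>x. flat 1 (r * x + (- r * \<alpha>)) * flat 1 ((- r) * x + r * \<beta>))"
    by (intro diff_times_mult diff_times_affine diff_times_flat)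
  also have "(\<lambda>x. flat 1 (r * x + (- r * \<alpha>)) * flat 1 ((- r) * x + r * \<beta>)) = bump r \<alpha> \<beta>"
    by (auto simp: bump_def algebra_simps)
  finally show ?thesis .
qed

lemma bump_nonneg: "0 \<le> bump r \<alpha> \<beta> x" and bump_le_1: "bump r \<alpha> \<beta> x \<le> 1"
  by (auto simp: bump_def flat_def intro!: mult_le_one)

lemma bump_eq_0: "r > 0 \<Longrightarrow> x \<notin> {\<alpha><..<\<beta>} \<Longrightarrow> bump r \<alpha> \<beta> x = 0"
  by (auto simp: bump_def flat_def zero_less_mult_iff)

lemma bump_pos: "r > 0 \<Longrightarrow> x \<in> {\<alpha><..<\<beta>} \<Longrightarrow> bump r \<alpha> \<beta> x > 0"
  by (auto simp: bump_def flat_def)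

lemma bump_tendsto_indicator:
  "(\<lambda>n. bump (real (Suc n)) \<alpha> \<beta> x) \<longlonglongrightarrow> indicat_real {\<alpha><..<\<beta>} x"
proof (cases "x \<in> {\<alpha><..<\<beta>}")
  case False
  then show ?thesis by (simp add: bump_eq_0)
next
  case True
  have *: "(\<lambda>n. flat 1 (real (Suc n) * t)) \<longlonglongrightarrow> 1" if "t > 0" for t
  proof -
    have "(\<lambda>n. exp (- 1 / (real (Suc n) * t))) \<longlonglongrightarrow> 1"
      using that by real_asymp
    then show ?thesis using that by (simp add: flat_def)
  qed
  have "(\<lambda>n. bump (real (Suc n)) \<alpha> \<beta> x) \<longlonglongrightarrow> 1 * 1"
    unfolding bump_def using True by (intro tendsto_mult *) auto
  then show ?thesis using True by simp
qed

lemma isCont_bump: "isCont (bump r \<alpha> \<beta>) x"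
  by (rule differentiable_imp_continuous_within[OF diff_times_differentiable[OF diff_times_bump[of 0]]])

section \<open>Construction of test functions\<close>

lemma test_functionI:
  assumes "\<And>n. diff_times n \<psi>" and "-R < \<alpha>" "\<beta> < R" and "\<And>x. x \<notin> {\<alpha>..\<beta>} \<Longrightarrow> \<psi> x = 0"
  shows "test_function R \<psi>"
proof -
  have "{x. \<psi> x \<noteq> 0} \<subseteq> {\<alpha>..\<beta>}" using assms(4) by blast
  then have "closure {x. \<psi> x \<noteq> 0} \<subseteq> {\<alpha>..\<beta>}" by (simp add: closure_minimal)
  then show ?thesis
    unfolding test_function_def using assms diff_times_all_iff[of \<psi>] by fastforce
qed

lemma test_function_bump:
  "r > 0 \<Longrightarrow> -R < \<alpha> \<Longrightarrow> \<beta> < R \<Longrightarrow> test_function R (bump r \<alpha> \<beta>)"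
  by (rule test_functionI[of _ R \<alpha> \<beta>]) (auto intro: diff_times_bump simp: bump_eq_0)

text \<open>Vanishing mean is exactly what brings the antiderivative that starts at 0 in \<alpha>
  back to 0 in \<beta>; on either side of the interval it is constant, so its support stays
  inside.\<close>

lemma test_function_antiderivative:
  assumes "\<And>n. diff_times n \<kappa>" and "-R < \<alpha>" "\<beta> < R" "\<alpha> \<le> \<beta>"
    and "\<And>x. x \<notin> {\<alpha>..\<beta>} \<Longrightarrow> \<kappa> x = 0" and "(\<kappa> has_integral 0) {\<alpha>..\<beta>}"
  obtains \<psi> where "test_function R \<psi>" "deriv \<psi> = \<kappa>"
proof -
  have "isCont \<kappa> x" for x
    using diff_times_differentiable[OF assms(1)] differentiable_imp_continuous_within by blast
  \<comment> \<open>The antiderivative is taken on the whole line because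
    \<open>test_function\<close> asks for differentiability at every real.\<close>
  then have "\<exists>F. \<forall>x::real. (-\<infinity>::ereal) < x \<longrightarrow> x < (\<infinity>::ereal) \<longrightarrow> (F has_vector_derivative \<kappa> x) (at x)"
    by (intro einterval_antiderivative) auto
  then obtain F where F: "(F has_vector_derivative \<kappa> x) (at x)" for x by auto
  define \<psi> where "\<psi> = (\<lambda>x. F x - F \<alpha>)"
  have D: "(\<psi> has_real_derivative \<kappa> x) (at x)" for x
    using F[of x] unfolding \<psi>_def has_real_derivative_iff_has_vector_derivative[symmetric]
    by (auto intro!: derivative_eq_intros)
  have "(\<kappa> has_integral (\<psi> \<beta> - \<psi> \<alpha>)) {\<alpha>..\<beta>}"
    using assms(4) D
    by (intro fundamental_theorem_of_calculus)
       (auto simp: has_real_derivative_iff_has_vector_derivative[symmetric] intro: DERIV_subset)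
  then have "\<psi> \<beta> - \<psi> \<alpha> = 0"
    using assms(6) by (rule has_integral_unique)
  then have end0: "\<psi> \<beta> = 0" "\<psi> \<alpha> = 0"
    by (simp_all add: \<psi>_def)
  have 1: "\<psi> x = 0" if "x < \<alpha>" for x
  proof -
    have "\<psi> x = \<psi> \<alpha>"
    proof (rule DERIV_isconst2[of x \<alpha>, symmetric, OF that])
      show "continuous_on {x..\<alpha>} \<psi>" using D by (meson DERIV_atLeastAtMost_imp_continuous_on)
      show "DERIV \<psi> y :> 0" if "x < y" "y < \<alpha>" for y
        using D[of y] assms(5)[of y] that by simp
    qed (use that in auto)
    then show ?thesis using end0 by simp
  qed
  have 2: "\<psi> x = 0" if "x > \<beta>" for x
  proof -
    have "\<psi> x = \<psi> \<beta>"
    proof (rule DERIV_isconst2[of \<beta> x, OF that])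
      show "continuous_on {\<beta>..x} \<psi>" using D by (meson DERIV_atLeastAtMost_imp_continuous_on)
      show "DERIV \<psi> y :> 0" if "\<beta> < y" "y < x" for y
        using D[of y] assms(5)[of y] that by simp
    qed (use that in auto)
    then show ?thesis using end0 by simp
  qed
  have dk: "deriv \<psi> = \<kappa>" using D by (intro ext DERIV_imp_deriv)
  have "diff_times n \<psi>" for n
    by (cases n) (use D assms(1) dk in \<open>auto simp: real_differentiable_def\<close>)
  then have "test_function R \<psi>"
    by (rule test_functionI) (use assms 1 2 in auto)
  then show ?thesis using dk that by blast
qed

section \<open>The fundamental lemma and weak derivatives\<close>

abbreviation leb :: "real \<Rightarrow> real measure" where "leb R \<equiv> lebesgue_on (Om R)"

lemma finite_measure_leb: "finite_measure (leb R)"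
  by (rule finite_measure_lebesgue_on) simp

lemma borel_measurable_leb_continuous:
  "continuous_on (Om R) f \<Longrightarrow> f \<in> borel_measurable (leb R)" for f :: "real \<Rightarrow> real"
  by (rule continuous_imp_measurable_on_sets_lebesgue) auto

lemma measurable_id_leb [measurable]: "(\<lambda>x. x) \<in> measurable (leb R) borel"
  using borel_measurable_leb_continuous[of R "\<lambda>x. x"] by simp

text \<open>Translates between the measure-theoretic quantifier and negligible exceptional sets, the
  language of the spike lemmas for the gauge integral.\<close>

lemma AE_leb_iff: "(AE x in leb R. P x) \<longleftrightarrow> (\<exists>N. negligible N \<and> (\<forall>x\<in>Om R - N. P x))"
proof
  assume "AE x in leb R. P x"
  then have "AE x in lebesgue. x \<in> Om R \<longrightarrow> P x"
    by (subst (asm) AE_restrict_space_iff) auto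
  then obtain N where "N \<in> null_sets lebesgue" "{x. \<not> (x \<in> Om R \<longrightarrow> P x)} \<subseteq> N"
    by (auto simp: eventually_ae_filter)
  then show "\<exists>N. negligible N \<and> (\<forall>x\<in>Om R - N. P x)"
    by (intro exI[of _ N]) (auto simp: negligible_iff_null_sets)
next
  assume "\<exists>N. negligible N \<and> (\<forall>x\<in>Om R - N. P x)"
  then obtain N where "N \<in> null_sets lebesgue" "\<forall>x\<in>Om R - N. P x"
    by (auto simp: negligible_iff_null_sets)
  then have "AE x in lebesgue. x \<in> Om R \<longrightarrow> P x"
    by (intro AE_I'[of N]) auto
  then show "AE x in leb R. P x"
    by (intro AE_restrict_space_iff[THEN iffD2]) auto
qed

lemma borel_measurable_leb_AE_cong:
  fixes f g :: "real \<Rightarrow> real"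
  assumes "f \<in> borel_measurable (leb R)" and "AE x in leb R. g x = f x"
  shows "g \<in> borel_measurable (leb R)"
proof -
  obtain N where "negligible N" "\<forall>x\<in>Om R - N. g x = f x"
    using assms(2) by (auto simp: AE_leb_iff)
  then have "g measurable_on Om R"
    using assms(1) by (auto intro: measurable_on_spike[where f = f and S = N] simp flip: measurable_on_iff_borel_measurable)
  then show ?thesis by (simp add: measurable_on_iff_borel_measurable)
qed

lemma integrable_imp_locally_integrable:
  assumes "integrable (leb R) u"
  shows "locally_integrable R u"
  unfolding locally_integrable_def
proof safe
  fix K :: "real set" assume K: "compact K" "K \<subseteq> Om R"
  have "u absolutely_integrable_on Om R"
    using assms by (simp add: set_integrable_def integrable_restrict_space)
  then show "u absolutely_integrable_on K"
    using K by (rule_tac set_integrable_subset) (auto simp: lmeasurable_compact fmeasurableD)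
qed

lemma locally_integrable_AE_cong:
  assumes "locally_integrable R u" and "AE x in leb R. v x = u x"
  shows "locally_integrable R v"
proof -
  obtain N where N: "negligible N" "\<forall>x\<in>Om R - N. v x = u x"
    using assms(2) by (auto simp: AE_leb_iff)
  show ?thesis
    unfolding locally_integrable_def
  proof safe
    fix K assume "compact K" "K \<subseteq> Om R"
    then show "v absolutely_integrable_on K"
      using assms(1) N by (auto simp: locally_integrable_def intro: absolutely_integrable_spike[where f = u and S = N])
  qed
qed

section \<open>Testing against bumps\<close>

lemma integrable_leb_restrict:
  fixes q :: "real \<Rightarrow> real"
  assumes "K \<subseteq> Om R"
  shows "integrable (leb R) (\<lambda>x. indicator K x * q x) \<longleftrightarrow> q absolutely_integrable_on K"
proof -
  have "(\<lambda>x. indicator (Om R) x * (indicator K x * q x)) = (\<lambda>x. indicator K x * q x)"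
    using assms by (auto simp: indicator_def fun_eq_iff)
  then show ?thesis by (simp add: set_integrable_def integrable_restrict_space)
qed

lemma integral_leb_restrict:
  fixes q :: "real \<Rightarrow> real"
  assumes "K \<subseteq> Om R" "q absolutely_integrable_on K"
  shows "(LINT x|leb R. indicator K x * q x) = integral K q"
proof -
  have "(\<lambda>x. indicator (Om R) x * (indicator K x * q x)) = (\<lambda>x. indicator K x * q x)"
    using assms by (auto simp: indicator_def fun_eq_iff)
  then have "(LINT x|leb R. indicator K x * q x) = (LINT x:K|lebesgue. q x)"
    by (simp add: set_lebesgue_integral_def integral_restrict_space)
  then show ?thesis using assms by (simp add: set_lebesgue_integral_eq_integral(2))
qed

text \<open>Dominated convergence from bumps to the indicator of the open interval. As q is only
  locally integrable, the dominating function is q cut off to the compact interval, which changes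
  nothing because the bumps vanish outside it.\<close>

lemma integral_eq_0_of_bumps:
  assumes q: "locally_integrable R q"
    and bumps: "\<And>n \<alpha> \<beta>. -R < \<alpha> \<Longrightarrow> \<alpha> < \<beta> \<Longrightarrow> \<beta> < R \<Longrightarrow>
       (LINT x|leb R. q x * bump (real (Suc n)) \<alpha> \<beta> x) = 0"
    and "-R < \<alpha>" "\<alpha> < \<beta>" "\<beta> < R"
  shows "integral {\<alpha>..\<beta>} q = 0"
proof -
  let ?K = "{\<alpha>..\<beta>}"
  have K: "?K \<subseteq> Om R" using assms by auto
  have qK: "q absolutely_integrable_on ?K"
    using q K by (auto simp: locally_integrable_def)
  then have int: "integrable (leb R) (\<lambda>x. indicator ?K x * q x)"
    by (simp add: integrable_leb_restrict[OF K])
  have b [measurable]: "bump r \<alpha> \<beta> \<in> borel_measurable (leb R)" for r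
    by (intro borel_measurable_leb_continuous continuous_at_imp_continuous_on ballI isCont_bump)
  have m [measurable]: "(\<lambda>x. indicator ?K x * q x) \<in> borel_measurable (leb R)"
    using int by (rule borel_measurable_integrable)
  have i [measurable]: "(indicat_real {\<alpha><..<\<beta>}) \<in> borel_measurable (leb R)"
    by measurable
  have "(\<lambda>n. LINT x|leb R. (indicator ?K x * q x) * bump (real (Suc n)) \<alpha> \<beta> x)
      \<longlonglongrightarrow> (LINT x|leb R. (indicator ?K x * q x) * indicator {\<alpha><..<\<beta>} x)"
  proof (rule integral_dominated_convergence[where w = "\<lambda>x. \<bar>indicator ?K x * q x\<bar>"])
    show "AE x in leb R. (\<lambda>n. (indicator ?K x * q x) * bump (real (Suc n)) \<alpha> \<beta> x)
        \<longlonglongrightarrow> (indicator ?K x * q x) * indicator {\<alpha><..<\<beta>} x"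
      by (intro AE_I2 tendsto_mult_left bump_tendsto_indicator)
    show "AE x in leb R. norm ((indicator ?K x * q x) * bump (real (Suc n)) \<alpha> \<beta> x)
        \<le> \<bar>indicator ?K x * q x\<bar>" for n
      by (intro AE_I2) (auto simp: abs_mult bump_nonneg bump_le_1 intro!: mult_right_le_one_le)
  qed (use int b[of "real (Suc _)"] m i in \<open>auto intro!: borel_measurable_times\<close>)
  moreover have "(LINT x|leb R. (indicator ?K x * q x) * bump (real (Suc n)) \<alpha> \<beta> x) = 0" for n
  proof -
    have "(\<lambda>x. (indicator ?K x * q x) * bump (real (Suc n)) \<alpha> \<beta> x) = (\<lambda>x. q x * bump (real (Suc n)) \<alpha> \<beta> x)"
    proof
      show "(indicator ?K x * q x) * bump (real (Suc n)) \<alpha> \<beta> x = q x * bump (real (Suc n)) \<alpha> \<beta> x" for x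
        using bump_eq_0[of "real (Suc n)" x \<alpha> \<beta>] by (cases "x \<in> {\<alpha>..\<beta>}") auto
    qed
    then show ?thesis using bumps[of \<alpha> \<beta> n] assms by (simp only:)
  qed
  ultimately have "(LINT x|leb R. (indicator ?K x * q x) * indicator {\<alpha><..<\<beta>} x) = 0"
    by (simp add: LIMSEQ_const_iff)
  moreover have "(indicator ?K x * q x) * indicator {\<alpha><..<\<beta>} x = indicator {\<alpha><..<\<beta>} x * q x" for x
    by (auto simp: indicator_def)
  ultimately have "(LINT x|leb R. indicator {\<alpha><..<\<beta>} x * q x) = 0"
    by simp
  moreover have "q absolutely_integrable_on {\<alpha><..<\<beta>}"
    by (rule set_integrable_subset[OF qK]) auto
  moreover have "{\<alpha><..<\<beta>} \<subseteq> Om R" using assms by auto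
  ultimately have "integral {\<alpha><..<\<beta>} q = 0"
    using integral_leb_restrict[of "{\<alpha><..<\<beta>}" R q] by simp
  then show ?thesis by (simp add: integral_open_interval_real)
qed

text \<open>Lebesgue differentiation turns vanishing integrals over subintervals into vanishing almost
  everywhere; the compact exhaustion is needed because \<open>q\<close> is only locally integrable.\<close>

lemma AE_eq_0_of_bumps:
  assumes q: "locally_integrable R q"
    and bumps: "\<And>n \<alpha> \<beta>. -R < \<alpha> \<Longrightarrow> \<alpha> < \<beta> \<Longrightarrow> \<beta> < R \<Longrightarrow>
       (LINT x|leb R. q x * bump (real (Suc n)) \<alpha> \<beta> x) = 0"
  shows "AE x in leb R. q x = 0"
proof -
  define K where "K = (\<lambda>k::nat. {-R + 1 / Suc k..R - 1 / Suc k})"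
  define f where "f = (\<lambda>k x. if x \<in> K k then q x else 0)"
  have KOm: "K k \<subseteq> Om R" for k
  proof -
    have pos: "1 / real (Suc k) > 0" by simp
    show ?thesis
    proof
      fix x assume "x \<in> K k"
      then have "-R + 1 / real (Suc k) \<le> x" "x \<le> R - 1 / real (Suc k)"
        by (simp_all add: K_def)
      with pos have "-R < x" "x < R" by linarith+
      then show "x \<in> Om R" by simp
    qed
  qed
  have "q absolutely_integrable_on K k" for k
    using q KOm[of k] by (auto simp: locally_integrable_def K_def)
  then have "f k absolutely_integrable_on UNIV" for k
    unfolding f_def by (simp add: absolutely_integrable_restrict_UNIV)
  then have "f k integrable_on UNIV" for k
    by (rule set_lebesgue_integral_eq_integral(1))
  then have "f k integrable_on cbox a b" for k a b
    by (rule integrable_on_subcbox) auto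
  \<comment> \<open>Lebesgue differentiation in one-sided form: outside N the averages over {x..x+h}
    converge to the value at x.\<close>
  then have "\<exists>N. negligible N \<and> (\<forall>x e. x \<notin> N \<longrightarrow> 0 < e \<longrightarrow>
      (\<exists>d>0. \<forall>h. 0 < h \<and> h < d \<longrightarrow> norm (integral (cbox x (x + h *\<^sub>R One)) (f k) /\<^sub>R h ^ DIM(real) - f k x) < e))" for k
    by (rule integrable_ccontinuous_explicit[of "f k"]) blast
  then have "\<forall>k. \<exists>N. negligible N \<and> (\<forall>x e. x \<notin> N \<longrightarrow> 0 < e \<longrightarrow>
      (\<exists>d>0. \<forall>h. 0 < h \<and> h < d \<longrightarrow> norm (integral (cbox x (x + h)) (f k) / h - f k x) < e))"
    by (simp add: divide_inverse_commute)
  from choice[OF this] obtain N where N: "\<And>k. negligible (N k)"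
    "\<And>k x e. x \<notin> N k \<Longrightarrow> 0 < e \<Longrightarrow>
      \<exists>d>0. \<forall>h. 0 < h \<and> h < d \<longrightarrow> norm (integral (cbox x (x + h)) (f k) / h - f k x) < e"
    by blast
  have "q x = 0" if x: "x \<in> Om R" "x \<notin> (\<Union>k. N k)" for x
  proof -
    define \<delta> where "\<delta> = min (R - x) (x + R)"
    have \<delta>: "\<delta> > 0" using x by (auto simp: \<delta>_def)
    then obtain k where k: "1 / real (Suc k) < \<delta>" by (metis inverse_eq_divide reals_Archimedean)
    have xk: "-R + 1 / Suc k < x" "x < R - 1 / Suc k" using k by (auto simp: \<delta>_def)
    have "\<bar>q x\<bar> < e" if "e > 0" for e
    proof -
      obtain d where d: "d > 0" "\<And>h. 0 < h \<Longrightarrow> h < d \<Longrightarrow> norm (integral (cbox x (x + h)) (f k) / h - f k x) < e"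
        using N(2)[of x k e] x \<open>e > 0\<close> by auto
      \<comment> \<open>Halving d gives h < d; the second bound keeps {x..x+h} inside
        \<open>K k\<close>, where \<open>f k\<close> agrees with q.\<close>
      define h where "h = min (d / 2) (R - 1 / Suc k - x)"
      have h: "0 < h" "h < d" "x + h \<le> R - 1 / Suc k"
        using d(1) xk by (auto simp: h_def)
      have sub: "y \<in> K k" if "y \<in> {x..x+h}" for y
        using that h xk unfolding K_def by auto
      have "integral {x..x+h} (f k) = integral {x..x+h} q"
        by (rule integral_cong) (use sub in \<open>auto simp: f_def\<close>)
      also have "\<dots> = 0"
        using x h KOm[of k] sub[of "x+h"]
        by (intro integral_eq_0_of_bumps[OF q bumps]) auto
      finally have "integral (cbox x (x + h)) (f k) = 0" by simp
      then show ?thesis using d(2)[OF h(1,2)] xk by (auto simp: f_def K_def)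
    qed
    \<comment> \<open>If q x were nonzero, the choice e = \<bar>q x\<bar> would give \<bar>q x\<bar>
      < \<bar>q x\<bar>.\<close>
    from this[of "\<bar>q x\<bar>"] show ?thesis by auto
  qed
  moreover have "negligible (\<Union>k. N k)" using N(1) by (intro negligible_countable_Union) auto
  ultimately show ?thesis by (auto simp: AE_leb_iff intro!: exI[of _ "\<Union>k. N k"])
qed

text \<open>Bumps are test functions, so the difference of two weak derivatives integrates to 0
  against each of them. The integral may be split because a locally integrable function times a
  compactly supported bump is integrable.\<close>

lemma weak_deriv_unique:
  assumes "has_weak_deriv R u v" "has_weak_deriv R u v'"
  shows "AE x in leb R. v x = v' x"
proof -
  have loc: "locally_integrable R v" "locally_integrable R v'"
    using assms by (auto simp: has_weak_deriv_def)
  have "AE x in leb R. v x - v' x = 0"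
  proof (rule AE_eq_0_of_bumps)
    show "locally_integrable R (\<lambda>x. v x - v' x)"
      using loc by (auto simp: locally_integrable_def intro: set_integral_diff)
    fix n \<alpha> \<beta> assume ab: "-R < \<alpha>" "\<alpha> < \<beta>" "\<beta> < R"
    let ?b = "bump (real (Suc n)) \<alpha> \<beta>"
    have bm: "?b \<in> borel_measurable (leb R)"
      by (intro borel_measurable_leb_continuous continuous_at_imp_continuous_on ballI isCont_bump)
    have int: "integrable (leb R) (\<lambda>x. w x * ?b x)" if "locally_integrable R w" for w
    proof -
      have "w absolutely_integrable_on {\<alpha>..\<beta>}"
        using that ab unfolding locally_integrable_def by (elim allE[of _ "{\<alpha>..\<beta>}"]) auto
      then have i: "integrable (leb R) (\<lambda>x. indicator {\<alpha>..\<beta>} x * w x)"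
        using ab by (subst integrable_leb_restrict) auto
      have "integrable (leb R) (\<lambda>x. (indicator {\<alpha>..\<beta>} x * w x) * ?b x)"
      proof (rule Bochner_Integration.integrable_bound[OF i])
        show "(\<lambda>x. (indicator {\<alpha>..\<beta>} x * w x) * ?b x) \<in> borel_measurable (leb R)"
          using borel_measurable_times[OF borel_measurable_integrable[OF i] bm] .
        show "AE x in leb R. norm ((indicator {\<alpha>..\<beta>} x * w x) * ?b x) \<le> norm (indicator {\<alpha>..\<beta>} x * w x)"
          by (intro AE_I2) (auto simp: abs_mult bump_nonneg bump_le_1 intro!: mult_right_le_one_le)
      qed
      moreover have "(\<lambda>x. (indicator {\<alpha>..\<beta>} x * w x) * ?b x) = (\<lambda>x. w x * ?b x)"
      proof
        show "(indicator {\<alpha>..\<beta>} x * w x) * ?b x = w x * ?b x" for x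
          using bump_eq_0[of "real (Suc n)" x \<alpha> \<beta>] by (cases "x \<in> {\<alpha>..\<beta>}") auto
      qed
      ultimately show ?thesis by (simp only:)
    qed
    have "test_function R ?b" using ab by (intro test_function_bump) auto
    then have "(LINT x|leb R. u x * deriv ?b x) = - (LINT x|leb R. v x * ?b x)"
      "(LINT x|leb R. u x * deriv ?b x) = - (LINT x|leb R. v' x * ?b x)"
      using assms unfolding has_weak_deriv_def by blast+
    then have "(LINT x|leb R. v x * ?b x) = (LINT x|leb R. v' x * ?b x)"
      by linarith
    then show "(LINT x|leb R. (v x - v' x) * ?b x) = 0"
      using int loc by (simp add: left_diff_distrib)
  qed
  then show ?thesis by simp
qed

text \<open>Replaces the arbitrary representative picked by \<open>wderiv\<close> by any weak
  derivative at hand.\<close>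

lemma wderiv_AE_eq:
  assumes "has_weak_deriv R u v"
  shows "AE x in leb R. wderiv R u x = v x"
proof -
  have "has_weak_deriv R u (wderiv R u)"
    unfolding wderiv_def using someI[of "has_weak_deriv R u", OF assms] .
  then show ?thesis using assms weak_deriv_unique by blast
qed

lemma has_weak_deriv_AE_cong:
  assumes "has_weak_deriv R u v" "u \<in> borel_measurable (leb R)" "AE x in leb R. u' x = u x"
  shows "has_weak_deriv R u' v"
proof -
  have "(LINT x|leb R. u' x * \<psi> x) = (LINT x|leb R. u x * \<psi> x)" if "\<psi> \<in> borel_measurable (leb R)" for \<psi>
    using assms(2,3) borel_measurable_leb_AE_cong[OF assms(2,3)] that
    by (intro integral_cong_AE borel_measurable_times) auto
  moreover have "deriv \<psi> \<in> borel_measurable (leb R)" if "test_function R \<psi>" for \<psi>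
  proof -
    have "deriv \<psi> differentiable (at x)" for x
      using that unfolding test_function_def by (auto dest!: spec[of _ "1::nat"])
    then show ?thesis
      by (intro borel_measurable_leb_continuous continuous_at_imp_continuous_on ballI
          differentiable_imp_continuous_within)
  qed
  ultimately show ?thesis
    using assms locally_integrable_AE_cong[OF _ assms(3)] unfolding has_weak_deriv_def by simp
qed

section \<open>Functions with vanishing weak derivative\<close>

lemma has_integral_leb_supported:
  fixes f :: "real \<Rightarrow> real"
  assumes "continuous_on UNIV f" "-R < \<alpha>" "\<beta> < R" "\<And>x. x \<notin> {\<alpha>..\<beta>} \<Longrightarrow> f x = 0"
  shows "integrable (leb R) f" and "(f has_integral (LINT x|leb R. f x)) {\<alpha>..\<beta>}"
proof -
  have K: "{\<alpha>..\<beta>} \<subseteq> Om R" using assms by auto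
  have eq: "(\<lambda>x. indicator {\<alpha>..\<beta>} x * f x) = f"
    using assms(4) by (auto simp: indicator_def fun_eq_iff)
  have ai: "f absolutely_integrable_on {\<alpha>..\<beta>}"
    by (intro absolutely_integrable_continuous_real continuous_on_subset[OF assms(1)]) auto
  show "integrable (leb R) f"
    using integrable_leb_restrict[OF K, of f] ai by (simp add: eq)
  show "(f has_integral (LINT x|leb R. f x)) {\<alpha>..\<beta>}"
    using integral_leb_restrict[OF K ai] set_lebesgue_integral_eq_integral(1)[OF ai]
    by (simp add: eq has_integral_integrable_integral)
qed

lemma integrable_leb_mult_bounded:
  fixes q g :: "real \<Rightarrow> real"
  assumes "integrable (leb R) q" "g \<in> borel_measurable (leb R)" "\<And>x. x \<in> Om R \<Longrightarrow> \<bar>g x\<bar> \<le> C"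
  shows "integrable (leb R) (\<lambda>x. q x * g x)"
proof (rule Bochner_Integration.integrable_bound)
  show "integrable (leb R) (\<lambda>x. C * q x)" using assms(1) by simp
  show "(\<lambda>x. q x * g x) \<in> borel_measurable (leb R)"
    by (rule borel_measurable_times[OF borel_measurable_integrable[OF assms(1)] assms(2)])
  have "\<bar>q x * g x\<bar> \<le> \<bar>C * q x\<bar>" if "x \<in> Om R" for x
    using mult_left_mono[OF assms(3)[OF that], of "\<bar>q x\<bar>"] by (simp add: abs_mult mult.commute)
       (metis abs_ge_zero abs_of_nonneg assms(3) mult.commute order_trans that)
  then show "AE x in leb R. norm (q x * g x) \<le> norm (C * q x)"
    by (intro AE_I2) auto
qed

lemma continuous_on_bump: "continuous_on A (bump r \<alpha> \<beta>)"
  by (intro continuous_at_imp_continuous_on ballI isCont_bump)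

text \<open>The du Bois-Reymond lemma. A bump minus the multiple of a fixed bump \<theta> with the
  same integral has mean zero, hence is the derivative of a test function and pairs to 0 with q. So
  q acts on all bumps like one constant.\<close>

lemma AE_const_of_weak_deriv_0:
  assumes "R > 0" and q: "integrable (leb R) q"
    and zero: "\<And>\<psi>. test_function R \<psi> \<Longrightarrow> (LINT x|leb R. q x * deriv \<psi> x) = 0"
  shows "\<exists>c. AE x in leb R. q x = c"
proof -
  interpret finite_measure "leb R" by (rule finite_measure_leb)
  define \<theta> where "\<theta> = bump 1 (-R/2) (R/2)"
  define I where "I = (\<lambda>f::real\<Rightarrow>real. LINT x|leb R. f x)"
  have supp: "bump (real (Suc n)) \<alpha> \<beta> x = 0" if "x \<notin> {\<alpha>..\<beta>}" for n \<alpha> \<beta> x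
    using that by (intro bump_eq_0) auto
  have \<theta>: "integrable (leb R) \<theta>" "(\<theta> has_integral I \<theta>) {-R/2..R/2}"
    unfolding \<theta>_def I_def using \<open>R > 0\<close> supp[of _ "-R/2" "R/2" 0]
    by (intro has_integral_leb_supported[of "bump 1 (-R/2) (R/2)" R "-R/2" "R/2"] continuous_on_bump; simp)+
  have "I \<theta> \<noteq> 0"
  proof
    assume "I \<theta> = 0"
    then have "\<theta> 0 = 0"
      using \<theta>(2) \<open>R > 0\<close>
      by (intro has_integral_0_cbox_imp_0[of "-R/2" "R/2" \<theta>])
         (auto simp: \<theta>_def bump_nonneg intro!: continuous_on_bump)
    moreover have "\<theta> 0 > 0" unfolding \<theta>_def using \<open>R > 0\<close> by (intro bump_pos) auto
    ultimately show False by simp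
  qed
  \<comment> \<open>The only possible value: for constant q, the average with weight \<theta>
    returns that constant.\<close>
  define c where "c = I (\<lambda>x. q x * \<theta> x) / I \<theta>"
  have qb: "integrable (leb R) (\<lambda>x. q x * bump r \<alpha> \<beta> x)" for r \<alpha> \<beta>
    by (rule integrable_leb_mult_bounded[OF q, where C = 1])
       (auto intro!: borel_measurable_leb_continuous continuous_on_bump simp: bump_nonneg bump_le_1)
  have "AE x in leb R. q x - c = 0"
  proof (rule AE_eq_0_of_bumps)
    show "locally_integrable R (\<lambda>x. q x - c)"
      using q by (intro integrable_imp_locally_integrable) auto
    fix n \<alpha> \<beta> assume ab: "-R < \<alpha>" "\<alpha> < \<beta>" "\<beta> < R"
    define \<eta> where "\<eta> = bump (real (Suc n)) \<alpha> \<beta>"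
    define \<kappa> where "\<kappa> = (\<lambda>x. \<eta> x + (- (I \<eta> / I \<theta>)) * \<theta> x)"
    \<comment> \<open>One interval that contains both supports and still lies strictly inside
      (-R,R).\<close>
    define l r where "l = min \<alpha> (-R/2)" and "r = max \<beta> (R/2)"
    have lr: "-R < l" "l \<le> r" "r < R" using ab \<open>R > 0\<close> by (auto simp: l_def r_def)
    have \<eta>: "integrable (leb R) \<eta>"
      unfolding \<eta>_def using ab supp[of _ \<alpha> \<beta> n]
      by (intro has_integral_leb_supported[of _ R \<alpha> \<beta>] continuous_on_bump)
    have dk: "diff_times m \<kappa>" for m
      unfolding \<kappa>_def \<eta>_def \<theta>_def
      by (intro diff_times_add diff_times_mult diff_times_const diff_times_bump)
    have ksupp: "\<kappa> x = 0" if "x \<notin> {l..r}" for x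
    proof -
      have "x \<notin> {\<alpha>..\<beta>}" "x \<notin> {-R/2..R/2}" using that by (auto simp: l_def r_def)
      then show ?thesis
        using supp[of x \<alpha> \<beta> n] supp[of x "-R/2" "R/2" 0] by (simp add: \<kappa>_def \<eta>_def \<theta>_def)
    qed
    have kc: "continuous_on UNIV \<kappa>"
      unfolding \<kappa>_def \<eta>_def \<theta>_def by (intro continuous_intros continuous_on_bump)
    have "I \<kappa> = 0"
      using \<eta> \<theta>(1) \<open>I \<theta> \<noteq> 0\<close> unfolding I_def \<kappa>_def by simp
    then have "(\<kappa> has_integral 0) {l..r}"
      using has_integral_leb_supported(2)[OF kc lr(1,3) ksupp] by (simp add: I_def)
    then obtain \<psi> where "test_function R \<psi>" "deriv \<psi> = \<kappa>"
      using test_function_antiderivative[OF dk lr(1,3,2) ksupp] by blast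
    then have "I (\<lambda>x. q x * \<kappa> x) = 0" using zero[of \<psi>] by (simp add: I_def)
    moreover have "I (\<lambda>x. q x * \<kappa> x) = I (\<lambda>x. (q x * \<eta> x) + (- (I \<eta> / I \<theta>)) * (q x * \<theta> x))"
      by (rule arg_cong[of _ _ I]) (auto simp: \<kappa>_def algebra_simps)
    moreover have "\<dots> = I (\<lambda>x. q x * \<eta> x) + (- (I \<eta> / I \<theta>)) * I (\<lambda>x. q x * \<theta> x)"
      unfolding I_def \<eta>_def \<theta>_def using qb by simp
    ultimately have "I (\<lambda>x. q x * \<eta> x) - c * I \<eta> = 0" by (simp add: c_def)
    moreover have "I (\<lambda>x. (q x - c) * \<eta> x) = I (\<lambda>x. q x * \<eta> x) - c * I \<eta>"
      unfolding I_def using qb[of "real (Suc n)" \<alpha> \<beta>] \<eta> by (simp add: left_diff_distrib \<eta>_def)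
    ultimately show "(LINT x|leb R. (q x - c) * bump (real (Suc n)) \<alpha> \<beta> x) = 0"
      by (simp add: I_def \<eta>_def)
  qed
  then show ?thesis by (intro exI[of _ c]) simp
qed

section \<open>Primitives and integration by parts\<close>

definition prim :: "real \<Rightarrow> (real \<Rightarrow> real) \<Rightarrow> real \<Rightarrow> real" where
  "prim R w x = (LINT t|leb R. indicator {..x} t * w t)"

lemma test_function_deriv:
  assumes "test_function R \<psi>"
  shows "\<psi> differentiable (at x)" "continuous_on A \<psi>" "continuous_on A (deriv \<psi>)"
proof -
  show "\<psi> differentiable (at x)" for x
    using assms unfolding test_function_def by (auto dest!: spec[of _ "0::nat"])
  then show "continuous_on A \<psi>"
    by (intro continuous_at_imp_continuous_on ballI differentiable_imp_continuous_within)
  have "deriv \<psi> differentiable (at x)" for x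
    using assms unfolding test_function_def by (auto dest!: spec[of _ "1::nat"])
  then show "continuous_on A (deriv \<psi>)"
    by (intro continuous_at_imp_continuous_on ballI differentiable_imp_continuous_within)
qed

lemma continuous_on_bounded_Om:
  fixes f :: "real \<Rightarrow> real"
  assumes "continuous_on {-R..R} f"
  obtains C where "C \<ge> 0" "\<And>x. x \<in> {-R..R} \<Longrightarrow> \<bar>f x\<bar> \<le> C"
proof -
  have "bounded (f ` {-R..R})"
    using assms by (intro compact_imp_bounded compact_continuous_image) auto
  then obtain C where C: "\<forall>y\<in>f ` {-R..R}. norm y \<le> C"
    unfolding bounded_iff by blast
  have "\<bar>f x\<bar> \<le> max C 0" if "x \<in> {-R..R}" for x
    using bspec[OF C, of "f x"] that by (simp add: le_max_iff_disj)
  then show ?thesis using that[of "max C 0"] by auto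
qed

lemma test_function_endpoints:
  assumes "test_function R \<psi>" shows "\<psi> R = 0" "\<psi> (-R) = 0"
proof -
  have "x \<notin> closure {x. \<psi> x \<noteq> 0}" if "x \<notin> Om R" for x
    using assms that unfolding test_function_def by blast
  then have "\<psi> x = 0" if "x \<notin> Om R" for x
    using that closure_subset[of "{x. \<psi> x \<noteq> 0}"] by blast
  then show "\<psi> R = 0" "\<psi> (-R) = 0" by auto
qed

lemma integral_leb_eq_Icc:
  fixes f :: "real \<Rightarrow> real"
  assumes "continuous_on {-R..R} f" "t \<in> {-R..R}"
  shows "integrable (leb R) (\<lambda>x. indicator {t..} x * f x)"
    and "(LINT x|leb R. indicator {t..} x * f x) = integral {t..R} f"
proof -
  have t: "t \<in> {-R..R}" by fact
  let ?K = "{t..R} \<inter> Om R"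
  have eq: "indicat_real (Om R) x * (indicator {t..} x * f x) = indicator (Om R) x * (indicator ?K x * f x)" for x
    by (auto simp: indicator_def)
  have eq2: "indicat_real {t..} x * f x = indicator ?K x * f x" if "x \<in> space (leb R)" for x
    using that by (auto simp: indicator_def)
  have "f absolutely_integrable_on {t..R}"
    using t by (intro absolutely_integrable_continuous_real continuous_on_subset[OF assms(1)]) auto
  then have ai: "f absolutely_integrable_on ?K"
    by (rule set_integrable_subset) auto
  have K: "?K \<subseteq> Om R" by auto
  show "integrable (leb R) (\<lambda>x. indicator {t..} x * f x)"
    using integrable_leb_restrict[OF K, of f] ai
    by (intro iffD2[OF Bochner_Integration.integrable_cong[OF refl eq2]]) auto
  have "(LINT x|leb R. indicator {t..} x * f x) = (LINT x|leb R. indicator ?K x * f x)"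
    using eq2 by (rule Bochner_Integration.integral_cong[OF refl])
  also have "\<dots> = integral ?K f"
    by (rule integral_leb_restrict[OF K ai])
  also have "\<dots> = integral {t..R} f"
    by (rule integral_spike_set) (rule negligible_subset[of "{-R, R}"], use t in auto)+
  finally show "(LINT x|leb R. indicator {t..} x * f x) = integral {t..R} f" .
qed

lemma integral_test_function_deriv:
  assumes "test_function R \<psi>" "t \<in> {-R..R}"
  shows "(LINT x|leb R. indicator {t..} x * deriv \<psi> x) = - \<psi> t"
proof -
  have "(deriv \<psi> has_integral (\<psi> R - \<psi> t)) {t..R}"
  proof (rule fundamental_theorem_of_calculus)
    show "(\<psi> has_vector_derivative deriv \<psi> x) (at x within {t..R})" for x
      using differentiable_has_deriv[OF test_function_deriv(1)[OF assms(1)], of x]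
      by (auto simp: has_real_derivative_iff_has_vector_derivative[symmetric] intro: has_field_derivative_at_within)
  qed (use assms in auto)
  then show ?thesis
    using integral_leb_eq_Icc(2)[OF test_function_deriv(3)[OF assms(1)] assms(2)]
      test_function_endpoints[OF assms(1)] by (simp add: integral_unique)
qed

text \<open>Fubini for the kernel v(t) \<psi>'(x) on t \<le> x: integrating in t first gives the
  primitive, integrating in x first gives -\<psi>(t), as \<psi> vanishes at R. The indicator in
  \<open>prim\<close> makes both sides integrals over the same square, and v need only be
  integrable.\<close>

lemma integration_by_parts_prim:
  assumes v: "integrable (leb R) v" and \<psi>: "test_function R \<psi>"
  shows "(LINT x|leb R. prim R v x * deriv \<psi> x) = - (LINT x|leb R. v x * \<psi> x)"
proof -
  interpret finite_measure "leb R" by (rule finite_measure_leb)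
  interpret pair_sigma_finite "leb R" "leb R" ..
  obtain C where C: "C \<ge> 0" "\<And>x. x \<in> {-R..R} \<Longrightarrow> \<bar>deriv \<psi> x\<bar> \<le> C"
    using continuous_on_bounded_Om[OF test_function_deriv(3)[OF \<psi>]] by metis
  have vm [measurable]: "v \<in> borel_measurable (leb R)" using v by auto
  have pm [measurable]: "deriv \<psi> \<in> borel_measurable (leb R)"
    by (intro borel_measurable_leb_continuous test_function_deriv(3)[OF \<psi>])
  let ?f = "\<lambda>x t. indicat_real {t..} x * v t * deriv \<psi> x"
  have ind: "indicat_real {t..} x = (if t \<le> x then 1 else 0)" for t x
    by (simp add: indicator_def)
  \<comment> \<open>Written as a case distinction on t \<le> x, the indicator is seen to be
    measurable jointly in both variables.\<close>
  have meas: "case_prod ?f \<in> borel_measurable (leb R \<Otimes>\<^sub>M leb R)"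
    unfolding ind by measurable
  have bound: "\<bar>?f x t\<bar> \<le> C * \<bar>v t\<bar>" if "x \<in> Om R" for x t
  proof -
    have "\<bar>?f x t\<bar> \<le> \<bar>v t\<bar> * \<bar>deriv \<psi> x\<bar>" by (auto simp: indicator_def abs_mult)
    also have "\<dots> \<le> \<bar>v t\<bar> * C" using C(2)[of x] that by (intro mult_left_mono) auto
    finally show ?thesis by (simp add: mult.commute)
  qed
  have intf: "integrable (leb R) (\<lambda>t. ?f x t)" if "x \<in> Om R" for x
  proof (rule Bochner_Integration.integrable_bound)
    show "integrable (leb R) (\<lambda>t. C * v t)" using v by simp
    show "(\<lambda>t. ?f x t) \<in> borel_measurable (leb R)" unfolding ind by measurable
    show "AE t in leb R. norm (?f x t) \<le> norm (C * v t)"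
      using bound[OF that] C(1) by (intro AE_I2) (auto simp: abs_mult)
  qed
  have "integrable (leb R \<Otimes>\<^sub>M leb R) (case_prod ?f)"
  proof (rule Fubini_integrable[OF meas])
    show "AE x in leb R. integrable (leb R) (\<lambda>t. case_prod ?f (x, t))"
      using intf by (intro AE_I2) auto
    show "integrable (leb R) (\<lambda>x. LINT t|leb R. norm (case_prod ?f (x, t)))"
    proof (rule integrable_const_bound[where B = "LINT t|leb R. C * \<bar>v t\<bar>"])
      show "(\<lambda>x. LINT t|leb R. norm (case_prod ?f (x, t))) \<in> borel_measurable (leb R)"
        using meas by measurable
      have "(LINT t|leb R. \<bar>?f x t\<bar>) \<le> (LINT t|leb R. C * \<bar>v t\<bar>)" if "x \<in> Om R" for x
        using intf[OF that] v bound[OF that] by (intro integral_mono) auto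
      then show "AE x in leb R. norm (LINT t|leb R. norm (case_prod ?f (x, t))) \<le> (LINT t|leb R. C * \<bar>v t\<bar>)"
        by (intro AE_I2) (auto simp: integral_nonneg_AE)
    qed
  qed
  from Fubini_integral[OF this]
  have swap: "(LINT t|leb R. LINT x|leb R. ?f x t) = (LINT x|leb R. LINT t|leb R. ?f x t)" .
  have inner: "(LINT x|leb R. ?f x t) = - (v t * \<psi> t)" if "t \<in> Om R" for t
  proof -
    have "(LINT x|leb R. ?f x t) = (LINT x|leb R. v t * (indicat_real {t..} x * deriv \<psi> x))"
      by (rule arg_cong[of _ _ "integral\<^sup>L _"]) (auto simp: algebra_simps)
    also have "\<dots> = v t * (LINT x|leb R. indicat_real {t..} x * deriv \<psi> x)"
      by (rule integral_mult_right_zero)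
    finally show ?thesis using integral_test_function_deriv[OF \<psi>, of t] that by simp
  qed
  have "(LINT t|leb R. ?f x t) = prim R v x * deriv \<psi> x" for x
  proof -
    have "(LINT t|leb R. ?f x t) = (LINT t|leb R. (indicat_real {..x} t * v t) * deriv \<psi> x)"
      by (rule arg_cong[of _ _ "integral\<^sup>L _"]) (auto simp: indicator_def)
    then show ?thesis by (simp add: prim_def)
  qed
  with swap have "(LINT t|leb R. LINT x|leb R. ?f x t) = (LINT x|leb R. prim R v x * deriv \<psi> x)"
    by (simp only:)
  moreover have "(LINT t|leb R. LINT x|leb R. ?f x t) = (LINT t|leb R. - (v t * \<psi> t))"
    by (rule Bochner_Integration.integral_cong[OF refl]) (use inner in auto)
  ultimately show ?thesis by simp
qed

section \<open>Square-integrable functions and primitives\<close>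

lemma L2_measurable: "f \<in> L2 R \<Longrightarrow> f \<in> borel_measurable (leb R)"
  and L2_square_integrable: "f \<in> L2 R \<Longrightarrow> integrable (leb R) (\<lambda>x. (f x)\<^sup>2)"
  by (auto simp: L2_def)

lemma L2_norm_square: "(L2_norm R f)\<^sup>2 = (LINT x|leb R. (f x)\<^sup>2)"
  by (simp add: L2_norm_def integral_nonneg_AE)

lemma integrable_leb_const: "integrable (leb R) (\<lambda>x. k::real)"
  using finite_measure.integrable_const[OF finite_measure_leb] .

lemma L2_mult_integrable:
  assumes "f \<in> L2 R" "g \<in> L2 R"
  shows "integrable (leb R) (\<lambda>x. f x * g x)"
proof (rule Bochner_Integration.integrable_bound)
  show "integrable (leb R) (\<lambda>x. (f x)\<^sup>2 + (g x)\<^sup>2)"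
    using assms by (intro Bochner_Integration.integrable_add L2_square_integrable)
  show "(\<lambda>x. f x * g x) \<in> borel_measurable (leb R)"
    using assms by (intro borel_measurable_times L2_measurable)
  have "\<bar>f x * g x\<bar> \<le> (f x)\<^sup>2 + (g x)\<^sup>2" for x
  proof -
    have "2 * (\<bar>f x\<bar> * \<bar>g x\<bar>) \<le> (f x)\<^sup>2 + (g x)\<^sup>2"
      using sum_squares_bound[of "\<bar>f x\<bar>" "\<bar>g x\<bar>"] by (simp add: mult.assoc)
    moreover have "0 \<le> \<bar>f x\<bar> * \<bar>g x\<bar>" by simp
    ultimately show ?thesis unfolding abs_mult by linarith
  qed
  then show "AE x in leb R. norm (f x * g x) \<le> norm ((f x)\<^sup>2 + (g x)\<^sup>2)"
    by (intro AE_I2) auto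
qed

lemma L2_const: "(\<lambda>x. k) \<in> L2 R"
  by (simp add: L2_def integrable_leb_const)

lemma L2_integrable: "f \<in> L2 R \<Longrightarrow> integrable (leb R) f"
  using L2_mult_integrable[OF _ L2_const[of 1]] by simp

lemma L2_add_scaled:
  assumes "f \<in> L2 R" "g \<in> L2 R"
  shows "(\<lambda>x. f x + k * g x) \<in> L2 R"
proof -
  have "(\<lambda>x. (f x + k * g x)\<^sup>2) = (\<lambda>x. (f x)\<^sup>2 + (2 * k) * (f x * g x) + k\<^sup>2 * (g x)\<^sup>2)"
    by (auto simp: power2_eq_square algebra_simps)
  moreover have "integrable (leb R) (\<lambda>x. (f x)\<^sup>2 + (2 * k) * (f x * g x) + k\<^sup>2 * (g x)\<^sup>2)"
    using L2_mult_integrable[OF assms] L2_square_integrable[OF assms(1)] L2_square_integrable[OF assms(2)]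
    by simp
  moreover have "(\<lambda>x. f x + k * g x) \<in> borel_measurable (leb R)"
    using L2_measurable[OF assms(1)] L2_measurable[OF assms(2)] by simp
  ultimately show ?thesis by (simp add: L2_def)
qed

lemma L2_cmult: "f \<in> L2 R \<Longrightarrow> (\<lambda>x. k * f x) \<in> L2 R"
  using L2_add_scaled[OF L2_const[of 0], of f R k] by simp

lemma L2_AE_cong:
  assumes "f \<in> L2 R" "AE x in leb R. g x = f x"
  shows "g \<in> L2 R" "(LINT x|leb R. (g x)\<^sup>2) = (LINT x|leb R. (f x)\<^sup>2)"
proof -
  have m: "f \<in> borel_measurable (leb R)" "g \<in> borel_measurable (leb R)"
    using assms borel_measurable_leb_AE_cong[of f R g] by (auto simp: L2_def)
  have ae: "AE x in leb R. (g x)\<^sup>2 = (f x)\<^sup>2" using assms(2) by eventually_elim simp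
  have "integrable (leb R) (\<lambda>x. (g x)\<^sup>2)"
    using L2_square_integrable[OF assms(1)] m ae
    by (subst integrable_cong_AE[of _ _ "\<lambda>x. (f x)\<^sup>2"]) auto
  then show "g \<in> L2 R" using m by (simp add: L2_def)
  show "(LINT x|leb R. (g x)\<^sup>2) = (LINT x|leb R. (f x)\<^sup>2)"
    using m ae by (intro integral_cong_AE) auto
qed

lemma L2_bounded:
  assumes m: "f \<in> borel_measurable (leb R)" and h: "integrable (leb R) h"
    and le: "AE x in leb R. (f x)\<^sup>2 \<le> h x"
  shows "f \<in> L2 R" "(LINT x|leb R. (f x)\<^sup>2) \<le> (LINT x|leb R. h x)"
proof -
  have "integrable (leb R) (\<lambda>x. (f x)\<^sup>2)"
  proof (rule Bochner_Integration.integrable_bound[OF h])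
    show "AE x in leb R. norm ((f x)\<^sup>2) \<le> norm (h x)"
      using le by eventually_elim auto
  qed (use m in simp)
  then show "f \<in> L2 R" "(LINT x|leb R. (f x)\<^sup>2) \<le> (LINT x|leb R. h x)"
    using m h le by (auto simp: L2_def intro: integral_mono_AE)
qed

lemma L2_mult_bounded:
  assumes "f \<in> L2 R" "g \<in> borel_measurable (leb R)" "AE x in leb R. \<bar>g x\<bar> \<le> C"
  shows "(\<lambda>x. f x * g x) \<in> L2 R"
    and "(LINT x|leb R. (f x * g x)\<^sup>2) \<le> C\<^sup>2 * (LINT x|leb R. (f x)\<^sup>2)"
proof -
  have m: "(\<lambda>x. f x * g x) \<in> borel_measurable (leb R)"
    using assms L2_measurable by (intro borel_measurable_times) auto
  have i: "integrable (leb R) (\<lambda>x. C\<^sup>2 * (f x)\<^sup>2)" using L2_square_integrable[OF assms(1)] by simp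
  have le: "AE x in leb R. (f x * g x)\<^sup>2 \<le> C\<^sup>2 * (f x)\<^sup>2"
    using assms(3)
  proof eventually_elim
    case (elim x)
    then have "(g x)\<^sup>2 \<le> C\<^sup>2" by (rule abs_le_square_iff[THEN iffD1, OF order_trans[OF _ abs_ge_self]])
    then show ?case using mult_right_mono[of "(g x)\<^sup>2" "C\<^sup>2" "(f x)\<^sup>2"]
      by (simp add: power_mult_distrib mult.commute)
  qed
  show "(\<lambda>x. f x * g x) \<in> L2 R" by (rule L2_bounded(1)[OF m i le])
  show "(LINT x|leb R. (f x * g x)\<^sup>2) \<le> C\<^sup>2 * (LINT x|leb R. (f x)\<^sup>2)"
    using L2_bounded(2)[OF m i le] by simp
qed

lemma borel_measurable_leb_Icc:
  "continuous_on {-R..R} f \<Longrightarrow> f \<in> borel_measurable (leb R)" for f :: "real \<Rightarrow> real"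
  by (rule borel_measurable_leb_continuous, rule continuous_on_subset) auto

lemma L2_continuous:
  assumes "continuous_on {-R..R} f" shows "f \<in> L2 R"
proof -
  obtain C where "C \<ge> 0" "\<And>x. x \<in> {-R..R} \<Longrightarrow> \<bar>f x\<bar> \<le> C"
    using continuous_on_bounded_Om[OF assms] by metis
  then have "AE x in leb R. \<bar>f x\<bar> \<le> C" by (intro AE_I2) auto
  then show ?thesis
    using L2_mult_bounded(1)[OF L2_const[of 1] borel_measurable_leb_Icc[OF assms]] by simp
qed

text \<open>The integral of (f + k g)^2 is a nonnegative polynomial in k of degree at most
  two.\<close>

lemma L2_Cauchy_Schwarz:
  assumes "f \<in> L2 R" "g \<in> L2 R"
  shows "(LINT x|leb R. f x * g x)\<^sup>2 \<le> (LINT x|leb R. (f x)\<^sup>2) * (LINT x|leb R. (g x)\<^sup>2)"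
proof -
  let ?A = "LINT x|leb R. (f x)\<^sup>2" and ?B = "LINT x|leb R. f x * g x" and ?C = "LINT x|leb R. (g x)\<^sup>2"
  have nn: "0 \<le> ?A + (2 * k) * ?B + k\<^sup>2 * ?C" for k
  proof -
    have "(\<lambda>x. (f x + k * g x)\<^sup>2) = (\<lambda>x. (f x)\<^sup>2 + (2 * k) * (f x * g x) + k\<^sup>2 * (g x)\<^sup>2)"
      by (auto simp: power2_eq_square algebra_simps)
    then have "(LINT x|leb R. (f x + k * g x)\<^sup>2) = ?A + (2 * k) * ?B + k\<^sup>2 * ?C"
      using L2_mult_integrable[OF assms] L2_square_integrable[OF assms(1)] L2_square_integrable[OF assms(2)]
      by simp
    moreover have "0 \<le> (LINT x|leb R. (f x + k * g x)\<^sup>2)" by (simp add: integral_nonneg_AE)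
    ultimately show ?thesis by simp
  qed
  have C: "?C \<ge> 0" by (simp add: integral_nonneg_AE)
  show ?thesis
  proof (cases "?C = 0")
    case True
    have "?B = 0"
    proof (rule ccontr)
      assume "?B \<noteq> 0"
      \<comment> \<open>When \<open>?C\<close> is 0 the polynomial is affine in k, and this k would
        give it the value -1.\<close>
      then have "(2 * (- (?A + 1) / (2 * ?B))) * ?B = - (?A + 1)" by simp
      then show False using nn[of "- (?A + 1) / (2 * ?B)"] unfolding True by linarith
    qed
    then show ?thesis by (simp add: True)
  next
    case False
    with C have "?C > 0" by linarith
    \<comment> \<open>The minimizer of the quadratic.\<close>
    have "0 \<le> ?A + (2 * (- ?B / ?C)) * ?B + (- ?B / ?C)\<^sup>2 * ?C" by (rule nn)
    also have "\<dots> = ?A - ?B\<^sup>2 / ?C" using \<open>?C > 0\<close> by (simp add: field_simps power2_eq_square)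
    finally show ?thesis using \<open>?C > 0\<close> by (simp add: field_simps)
  qed
qed

section \<open>Primitives of square-integrable functions\<close>

lemma integrable_indicator_mult:
  "integrable (leb R) w \<Longrightarrow> integrable (leb R) (\<lambda>t. indicator {..x} t * w t)" for w :: "real \<Rightarrow> real"
  using integrable_mult_indicator[of "{..x} \<inter> Om R" "leb R" w]
  by (rule iffD1[OF Bochner_Integration.integrable_cong[OF refl], rotated])
     (auto simp: indicator_def sets_restrict_space_iff)

lemma prim_add_scaled:
  assumes "integrable (leb R) v" "integrable (leb R) w"
  shows "prim R (\<lambda>t. v t + k * w t) x = prim R v x + k * prim R w x"
proof -
  have "(\<lambda>t. indicator {..x} t * (v t + k * w t))
      = (\<lambda>t. indicator {..x} t * v t + k * (indicator {..x} t * w t))"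
    by (auto simp: algebra_simps)
  then show ?thesis
    using assms unfolding prim_def by (simp add: integrable_indicator_mult)
qed

lemma prim_AE_cong:
  assumes "v \<in> borel_measurable (leb R)" "AE x in leb R. w x = v x"
  shows "prim R w x = prim R v x"
proof -
  have "(\<lambda>t. indicat_real {..x} t) \<in> borel_measurable (leb R)" by measurable
  then show ?thesis
    unfolding prim_def using assms borel_measurable_leb_AE_cong[OF assms]
    by (intro integral_cong_AE borel_measurable_times) auto
qed

lemma prim_left: "prim R w (-R) = 0"
proof -
  have "(LINT t|leb R. indicator {..-R} t * w t) = (LINT t|leb R. 0)"
    by (rule Bochner_Integration.integral_cong) auto
  then show ?thesis by (simp add: prim_def)
qed

lemma prim_diff:
  assumes "integrable (leb R) w" "x \<le> y"
  shows "prim R w y - prim R w x = (LINT t|leb R. indicator {x<..y} t * w t)"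
proof -
  have "(\<lambda>t. indicator {x<..y} t * w t) = (\<lambda>t. indicator {..y} t * w t - indicator {..x} t * w t)"
    using assms(2) by (auto simp: indicator_def fun_eq_iff)
  then show ?thesis
    using assms(1) unfolding prim_def by (simp add: integrable_indicator_mult)
qed

text \<open>Cauchy--Schwarz against the indicator of the interval between x and y. This one estimate
  is behind the continuity of primitives, the supremum bound, the equicontinuity and the passage to
  the limit under \<open>prim\<close>.\<close>

lemma prim_holder:
  assumes w: "w \<in> L2 R"
  shows "(prim R w y - prim R w x)\<^sup>2 \<le> \<bar>y - x\<bar> * (LINT t|leb R. (w t)\<^sup>2)"
proof -
  have *: "(prim R w y - prim R w x)\<^sup>2 \<le> (y - x) * (LINT t|leb R. (w t)\<^sup>2)" if "x \<le> y" for x y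
  proof -
    have m: "indicat_real {x<..y} \<in> borel_measurable (leb R)" by measurable
    then have L2: "indicat_real {x<..y} \<in> L2 R"
      using L2_mult_bounded(1)[OF L2_const[of 1] m AE_I2, of 1] by simp
    have "(LINT t|leb R. (indicat_real {x<..y} t)\<^sup>2) = (LINT t|leb R. indicat_real {x<..y} t)"
      by (rule arg_cong[of _ _ "integral\<^sup>L _"]) (auto simp: indicator_def)
    also have "\<dots> = measure (leb R) ({x<..y} \<inter> Om R)" by simp
    also have "\<dots> = measure lebesgue ({x<..y} \<inter> Om R)"
      by (subst measure_restrict_space) auto
    also have "\<dots> \<le> measure lebesgue {x..y}"
      by (rule measure_mono_fmeasurable) auto
    also have "\<dots> = y - x" using that by simp
    finally have le: "(LINT t|leb R. (indicat_real {x<..y} t)\<^sup>2) \<le> y - x" .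
    have "(prim R w y - prim R w x)\<^sup>2 \<le> (LINT t|leb R. (indicat_real {x<..y} t)\<^sup>2) * (LINT t|leb R. (w t)\<^sup>2)"
      using L2_Cauchy_Schwarz[OF L2 w] prim_diff[OF L2_integrable[OF w] that] by simp
    also have "\<dots> \<le> (y - x) * (LINT t|leb R. (w t)\<^sup>2)"
      using le by (intro mult_right_mono) (simp_all add: integral_nonneg_AE)
    finally show ?thesis .
  qed
  show ?thesis
    using *[of x y] *[of y x] by (cases "x \<le> y") (auto simp: power2_commute)
qed

lemma continuous_on_prim:
  assumes w: "w \<in> L2 R" shows "continuous_on A (prim R w)"
proof -
  have "isCont (prim R w) x" for x
  proof -
    let ?W = "LINT t|leb R. (w t)\<^sup>2"
    have "((\<lambda>y. sqrt (\<bar>y - x\<bar> * ?W)) \<longlongrightarrow> sqrt (\<bar>x - x\<bar> * ?W)) (at x)"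
      by (intro tendsto_intros)
    then have "((\<lambda>y. sqrt (\<bar>y - x\<bar> * ?W)) \<longlongrightarrow> 0) (at x)" by simp
    then have "((\<lambda>y. prim R w y - prim R w x) \<longlongrightarrow> 0) (at x)"
    proof (rule Lim_null_comparison[rotated])
      show "\<forall>\<^sub>F y in at x. norm (prim R w y - prim R w x) \<le> sqrt (\<bar>y - x\<bar> * ?W)"
        by (intro always_eventually allI) (simp add: real_le_rsqrt prim_holder[OF w])
    qed
    then show ?thesis by (simp add: isCont_def LIM_zero_iff)
  qed
  then show ?thesis by (simp add: continuous_at_imp_continuous_on)
qed

lemma integrable_mult_deriv_test:
  assumes "continuous_on {-R..R} p" "test_function R \<psi>"
  shows "integrable (leb R) (\<lambda>x. p x * deriv \<psi> x)"
  using assms by (intro L2_mult_integrable L2_continuous test_function_deriv(3))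

lemma has_weak_deriv_prim:
  assumes v: "v \<in> L2 R" and u: "AE x in leb R. u x = c + prim R v x"
  shows "has_weak_deriv R u v"
proof -
  have c: "continuous_on {-R..R} (\<lambda>x. c + prim R v x)"
    by (intro continuous_intros continuous_on_prim v)
  have "has_weak_deriv R (\<lambda>x. c + prim R v x) v"
    unfolding has_weak_deriv_def
  proof (intro conjI allI impI integrable_imp_locally_integrable)
    fix \<psi> assume \<psi>: "test_function R \<psi>"
    \<comment> \<open>The constant c drops out because the derivative of a test function has
      integral 0.\<close>
    have "(LINT x|leb R. deriv \<psi> x) = (LINT x|leb R. indicator {-R..} x * deriv \<psi> x)"
      by (rule Bochner_Integration.integral_cong) auto
    also have "\<dots> = 0"
    proof (cases "R \<ge> 0")
      case True
      then show ?thesis using integral_test_function_deriv[OF \<psi>, of "-R"] test_function_endpoints[OF \<psi>] by simp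
    next
      case False
      then have "Om R = {}" by auto
      then show ?thesis by (simp add: integral_restrict_space)
    qed
    finally have "(LINT x|leb R. deriv \<psi> x) = 0" .
    moreover have "integrable (leb R) (deriv \<psi>)"
      using integrable_mult_deriv_test[OF _ \<psi>, of "\<lambda>_. 1"] by simp
    moreover have "integrable (leb R) (\<lambda>x. prim R v x * deriv \<psi> x)"
      by (intro integrable_mult_deriv_test \<psi> continuous_on_prim v)
    ultimately show "(LINT x|leb R. (c + prim R v x) * deriv \<psi> x) = - (LINT x|leb R. v x * \<psi> x)"
      using integration_by_parts_prim[OF L2_integrable[OF v] \<psi>] by (simp add: distrib_right)
  qed (use v c in \<open>auto intro: L2_integrable L2_continuous\<close>)
  then show ?thesis
    using borel_measurable_leb_Icc[OF c] u by (rule has_weak_deriv_AE_cong)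
qed

text \<open>By integration by parts, \<open>u\<close> minus the primitive of \<open>v\<close> pairs
  to 0 with every derivative of a test function, so it is constant. In dimension one, weak
  differentiability within L^2 thus means being an indefinite integral.\<close>

lemma weak_deriv_imp_prim:
  assumes "R > 0" and u: "u \<in> L2 R" and v: "v \<in> L2 R" and "has_weak_deriv R u v"
  shows "\<exists>c. AE x in leb R. u x = c + prim R v x"
proof -
  have "\<exists>c. AE x in leb R. u x - prim R v x = c"
  proof (rule AE_const_of_weak_deriv_0[OF \<open>R > 0\<close>])
    show "integrable (leb R) (\<lambda>x. u x - prim R v x)"
      using L2_integrable[OF u] L2_integrable[OF L2_continuous[OF continuous_on_prim[OF v]]]
      by (rule Bochner_Integration.integrable_diff)
    fix \<psi> assume \<psi>: "test_function R \<psi>"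
    have "integrable (leb R) (\<lambda>x. u x * deriv \<psi> x)"
      using u L2_continuous[OF test_function_deriv(3)[OF \<psi>]] by (rule L2_mult_integrable)
    moreover have "integrable (leb R) (\<lambda>x. prim R v x * deriv \<psi> x)"
      by (intro integrable_mult_deriv_test \<psi> continuous_on_prim v)
    moreover have "(LINT x|leb R. u x * deriv \<psi> x) = - (LINT x|leb R. v x * \<psi> x)"
      using assms(4) \<psi> by (simp add: has_weak_deriv_def)
    ultimately show "(LINT x|leb R. (u x - prim R v x) * deriv \<psi> x) = 0"
      using integration_by_parts_prim[OF L2_integrable[OF v] \<psi>] by (simp add: left_diff_distrib)
  qed
  then obtain c where "AE x in leb R. u x - prim R v x = c" ..
  then have "AE x in leb R. u x = c + prim R v x" by eventually_elim simp
  then show ?thesis ..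
qed

section \<open>Representation of \<open>H\<^sup>2\<close> functions\<close>

text \<open>The data of a function in \<open>H\<^sup>2\<close>: continuous representatives \<open>p\<close>, \<open>q\<close> of
  the function and its first derivative, and a second derivative \<open>w\<close>.\<close>

definition H2_rep :: "real \<Rightarrow> (real \<Rightarrow> real) \<Rightarrow> (real \<Rightarrow> real) \<Rightarrow> (real \<Rightarrow> real) \<Rightarrow> bool" where
  "H2_rep R p q w \<longleftrightarrow> w \<in> L2 R \<and> (\<forall>x\<in>{-R..R}. q x = q (-R) + prim R w x) \<and>
     (\<forall>x\<in>{-R..R}. p x = p (-R) + prim R q x)"

lemma continuous_on_prim_rep:
  assumes "w \<in> L2 R" "\<forall>x\<in>{-R..R}. q x = c + prim R w x"
  shows "continuous_on {-R..R} q"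
proof -
  have "continuous_on {-R..R} (\<lambda>x. c + prim R w x)"
    by (intro continuous_intros continuous_on_prim assms(1))
  then show ?thesis
    by (rule continuous_on_eq) (use assms(2) in auto)
qed

lemma H2_rep_props:
  assumes "H2_rep R p q w"
  shows "continuous_on {-R..R} p" "continuous_on {-R..R} q" "p \<in> L2 R" "q \<in> L2 R" "w \<in> L2 R"
proof -
  show w: "w \<in> L2 R" using assms by (simp add: H2_rep_def)
  show q: "continuous_on {-R..R} q"
    using assms unfolding H2_rep_def by (intro continuous_on_prim_rep[OF w, of _ "q (-R)"]) blast
  then show q2: "q \<in> L2 R" by (rule L2_continuous)
  show p: "continuous_on {-R..R} p"
    using assms unfolding H2_rep_def by (intro continuous_on_prim_rep[OF q2, of _ "p (-R)"]) blast
  then show "p \<in> L2 R" by (rule L2_continuous)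
qed

lemma H2_rep_add_scaled:
  assumes "H2_rep R p q w" "H2_rep R p' q' w'"
  shows "H2_rep R (\<lambda>x. p x + k * p' x) (\<lambda>x. q x + k * q' x) (\<lambda>x. w x + k * w' x)"
proof -
  note P = H2_rep_props[OF assms(1)] H2_rep_props[OF assms(2)]
  have lin: "prim R (\<lambda>x. w x + k * w' x) x = prim R w x + k * prim R w' x"
    "prim R (\<lambda>x. q x + k * q' x) x = prim R q x + k * prim R q' x" for x
    by (intro prim_add_scaled L2_integrable P)+
  have eq: "q x = q (-R) + prim R w x" "p x = p (-R) + prim R q x"
    "q' x = q' (-R) + prim R w' x" "p' x = p' (-R) + prim R q' x" if "x \<in> {-R..R}" for x
    using assms that unfolding H2_rep_def by blast+
  show ?thesis unfolding H2_rep_def lin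
  proof (intro conjI ballI)
    show "(\<lambda>x. w x + k * w' x) \<in> L2 R" using P by (intro L2_add_scaled)
    show "q x + k * q' x = q (-R) + k * q' (-R) + (prim R w x + k * prim R w' x)"
      "p x + k * p' x = p (-R) + k * p' (-R) + (prim R q x + k * prim R q' x)" if x: "x \<in> {-R..R}" for x
      unfolding eq(1)[OF x] eq(2)[OF x] eq(3)[OF x] eq(4)[OF x] by (simp_all only: distrib_left ac_simps)
  qed
qed

lemma H2_rep_0: "H2_rep R (\<lambda>x. 0) (\<lambda>x. 0) (\<lambda>x. 0)"
proof -
  have "prim R (\<lambda>x. 0) x = 0" for x by (simp add: prim_def)
  then show ?thesis using L2_const[of 0 R] by (simp add: H2_rep_def)
qed

lemma H2_imp_rep:
  assumes "R > 0" "u \<in> H2 R"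
  obtains p q w where "H2_rep R p q w" "AE x in leb R. u x = p x"
proof -
  obtain v w where vw: "u \<in> L2 R" "v \<in> L2 R" "w \<in> L2 R" "has_weak_deriv R u v" "has_weak_deriv R v w"
    using assms(2) by (auto simp: H2_def W2_def)
  obtain c where c: "AE x in leb R. u x = c + prim R v x"
    using weak_deriv_imp_prim[OF assms(1) vw(1,2,4)] by blast
  obtain d where d: "AE x in leb R. v x = d + prim R w x"
    using weak_deriv_imp_prim[OF assms(1) vw(2,3,5)] by blast
  define q where "q = (\<lambda>x. d + prim R w x)"
  \<comment> \<open>The primitive is that of the continuous q, as \<open>H2_rep\<close> demands, and
    not that of v; the two coincide because q = v almost everywhere.\<close>
  define p where "p = (\<lambda>x. c + prim R q x)"
  have "prim R q x = prim R v x" for x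
  proof (rule prim_AE_cong[OF L2_measurable[OF vw(2)]])
    show "AE x in leb R. q x = v x" using d by eventually_elim (simp add: q_def)
  qed
  then have "AE x in leb R. u x = p x" using c by (simp add: p_def)
  moreover have "H2_rep R p q w"
    using vw(3) by (simp add: H2_rep_def p_def q_def prim_left)
  ultimately show ?thesis using that by blast
qed

text \<open>The points of the open interval where the functions differ form an open negligible set,
  hence none exist; the end points follow by continuity. This makes boundary values well
  defined.\<close>

lemma continuous_AE_eq:
  fixes f g :: "real \<Rightarrow> real"
  assumes "R > 0" "continuous_on {-R..R} f" "continuous_on {-R..R} g" "AE x in leb R. f x = g x"
    and "x \<in> {-R..R}"
  shows "f x = g x"
proof -
  let ?h = "\<lambda>x. f x - g x"
  have cl: "closure (Om R) = {-R..R}" using assms(1) by simp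
  have h: "continuous_on (closure (Om R)) ?h"
    unfolding cl by (intro continuous_intros assms)
  obtain N where N: "negligible N" "\<forall>x\<in>Om R - N. f x = g x"
    using assms(4) by (auto simp: AE_leb_iff)
  have "open (Om R \<inter> ?h -` (- {0}))"
    using continuous_on_subset[OF h closure_subset] by (intro continuous_open_preimage) auto
  moreover have "negligible (Om R \<inter> ?h -` (- {0}))"
    using N by (intro negligible_subset[OF N(1)]) auto
  ultimately have "Om R \<inter> ?h -` (- {0}) = {}"
    using open_not_negligible by blast
  then have "\<And>x. x \<in> Om R \<Longrightarrow> ?h x = 0" by auto
  then have "?h x = 0"
    using continuous_constant_on_closure[OF h, of 0 x] assms(5) cl by blast
  then show ?thesis by simp
qed

lemma trace_eq:
  assumes "R > 0" "continuous_on {-R..R} p" "AE x in leb R. u x = p x" "x \<in> {-R..R}"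
  shows "trace R u x = p x"
proof -
  let ?P = "\<lambda>v. continuous_on {-R..R} v \<and> (AE x in leb R. v x = u x)"
  have "AE x in leb R. p x = u x" using assms(3) by eventually_elim simp
  then have "?P p" using assms(2) by simp
  then have "?P (trace R u)" unfolding trace_def by (rule someI[of ?P])
  then have c: "continuous_on {-R..R} (trace R u)" and ae: "AE x in leb R. trace R u x = u x" by auto
  have "AE x in leb R. trace R u x = p x"
    using ae assms(3) by eventually_elim simp
  then show ?thesis using continuous_AE_eq[OF assms(1) c assms(2) _ assms(4)] by blast
qed

text \<open>Eliminates the choice operators: \<open>wderiv\<close> is identified with the concrete
  data almost everywhere, \<open>trace\<close> at every point of the closed interval. From here on
  H^2 is handled through triples only.\<close>

lemma H2_repD:
  assumes "R > 0" and rep: "H2_rep R p q w" and u: "AE x in leb R. u x = p x"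
  shows "u \<in> H2 R" "AE x in leb R. wderiv R u x = q x" "AE x in leb R. wderiv R (wderiv R u) x = w x"
    and "\<And>x. x \<in> {-R..R} \<Longrightarrow> trace R u x = p x" "\<And>x. x \<in> {-R..R} \<Longrightarrow> trace R (wderiv R u) x = q x"
    and "(H2_norm R u)\<^sup>2 = (LINT x|leb R. (p x)\<^sup>2) + (LINT x|leb R. (q x)\<^sup>2) + (LINT x|leb R. (w x)\<^sup>2)"
proof -
  note P = H2_rep_props[OF rep]
  have eq: "q x = q (-R) + prim R w x" "p x = p (-R) + prim R q x" if "x \<in> Om R" for x
  proof -
    have "x \<in> {-R..R}" using that by auto
    then show "q x = q (-R) + prim R w x" "p x = p (-R) + prim R q x"
      using rep unfolding H2_rep_def by blast+
  qed
  have qw: "has_weak_deriv R v w" if v: "AE x in leb R. v x = q x" for v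
  proof (rule has_weak_deriv_prim[OF P(5), of _ "q (-R)"])
    have "AE x in leb R. x \<in> Om R" by (intro AE_I2) auto
    with v show "AE x in leb R. v x = q (-R) + prim R w x"
      by eventually_elim (metis eq(1))
  qed
  have uq: "has_weak_deriv R u q"
  proof (rule has_weak_deriv_prim[OF P(4), of _ "p (-R)"])
    have "AE x in leb R. x \<in> Om R" by (intro AE_I2) auto
    with u show "AE x in leb R. u x = p (-R) + prim R q x"
      by eventually_elim (metis eq(2))
  qed
  have u2: "u \<in> L2 R" by (rule L2_AE_cong(1)[OF P(3) u])
  show "u \<in> H2 R"
    using u2 P uq qw[of q] by (auto simp: H2_def W2_def)
  show du: "AE x in leb R. wderiv R u x = q x" by (rule wderiv_AE_eq[OF uq])
  show ddu: "AE x in leb R. wderiv R (wderiv R u) x = w x" by (rule wderiv_AE_eq[OF qw[OF du]])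
  show "trace R u x = p x" if "x \<in> {-R..R}" for x by (rule trace_eq[OF assms(1) P(1) u that])
  show "trace R (wderiv R u) x = q x" if "x \<in> {-R..R}" for x by (rule trace_eq[OF assms(1) P(2) du that])
  show "(H2_norm R u)\<^sup>2 = (LINT x|leb R. (p x)\<^sup>2) + (LINT x|leb R. (q x)\<^sup>2) + (LINT x|leb R. (w x)\<^sup>2)"
    unfolding H2_norm_def
    by (simp add: L2_norm_square integral_nonneg_AE
        L2_AE_cong(2)[OF P(3) u] L2_AE_cong(2)[OF P(4) du] L2_AE_cong(2)[OF P(5) ddu])
qed

text \<open>The embedding of H^1 into the continuous functions. Comparing q(x) with q(t) by
  \<open>prim_holder\<close> and integrating over t, an interval of length 2R, yields the constants
  1/R and 4R after division by 2R.\<close>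

lemma sup_le_L2_deriv:
  assumes "R > 0" "w \<in> L2 R" and eq: "\<forall>x\<in>{-R..R}. q x = q (-R) + prim R w x" and x: "x \<in> {-R..R}"
  shows "(q x)\<^sup>2 \<le> (1 / R) * (LINT t|leb R. (q t)\<^sup>2) + (4 * R) * (LINT t|leb R. (w t)\<^sup>2)"
proof -
  let ?W = "LINT t|leb R. (w t)\<^sup>2"
  have W: "?W \<ge> 0" by (simp add: integral_nonneg_AE)
  have "q \<in> L2 R" by (intro L2_continuous continuous_on_prim_rep[OF assms(2,3)])
  then have q2: "integrable (leb R) (\<lambda>t. (q t)\<^sup>2)" by (rule L2_square_integrable)
  have pt: "(q x)\<^sup>2 \<le> 2 * (q t)\<^sup>2 + 4 * R * ?W" if "t \<in> Om R" for t
  proof -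
    have "t \<in> {-R..R}" using that by auto
    then have "q x - q t = prim R w x - prim R w t"
      using bspec[OF eq x] bspec[OF eq, of t] by linarith
    then have "(q x - q t)\<^sup>2 \<le> \<bar>x - t\<bar> * ?W" using prim_holder[OF assms(2)] by simp
    also have "\<dots> \<le> (2 * R) * ?W" using x that W by (intro mult_right_mono) auto
    finally have "(q x - q t)\<^sup>2 \<le> 2 * R * ?W" .
    \<comment> \<open>The difference of the two sides is the square of q x - 2 q t.\<close>
    moreover have "(q x)\<^sup>2 \<le> 2 * (q t)\<^sup>2 + 2 * (q x - q t)\<^sup>2"
      using zero_le_power2[of "q x - 2 * q t"] by (simp add: power2_eq_square algebra_simps)
    ultimately show ?thesis by simp
  qed
  have m: "measure (leb R) (space (leb R)) = 2 * R"
    using assms(1) by (subst measure_restrict_space) auto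
  have "(LINT t|leb R. (q x)\<^sup>2) \<le> (LINT t|leb R. 2 * (q t)\<^sup>2 + 4 * R * ?W)"
    by (rule integral_mono) (use pt q2 in \<open>auto intro: integrable_leb_const\<close>)
  also have "\<dots> = 2 * (LINT t|leb R. (q t)\<^sup>2) + 4 * R * ?W * (2 * R)"
    using q2 m by (simp add: integrable_leb_const)
  finally have "2 * R * (q x)\<^sup>2 \<le> 2 * (LINT t|leb R. (q t)\<^sup>2) + 4 * R * ?W * (2 * R)"
    using m by simp
  then show ?thesis using assms(1) by (simp add: field_simps)
qed

section \<open>The boundary value problem\<close>

lemma H2_norm_nonneg: "0 \<le> H2_norm R u"
  by (simp add: H2_norm_def)

lemma H2_add_scaled:
  assumes "R > 0" "u \<in> H2 R" "v \<in> H2 R"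
  shows "(\<lambda>x. u x + k * v x) \<in> H2 R"
proof -
  obtain p q w where u: "H2_rep R p q w" "AE x in leb R. u x = p x" using H2_imp_rep[OF assms(1,2)] by blast
  obtain p' q' w' where v: "H2_rep R p' q' w'" "AE x in leb R. v x = p' x" using H2_imp_rep[OF assms(1,3)] by blast
  have "AE x in leb R. u x + k * v x = p x + k * p' x"
    using u(2) v(2) by eventually_elim simp
  then show ?thesis by (rule H2_repD(1)[OF assms(1) H2_rep_add_scaled[OF u(1) v(1)]])
qed

lemma H2_norm_AE_cong:
  assumes "R > 0" "u \<in> H2 R" "AE x in leb R. v x = u x"
  shows "H2_norm R v = H2_norm R u"
proof -
  obtain p q w where u: "H2_rep R p q w" "AE x in leb R. u x = p x" using H2_imp_rep[OF assms(1,2)] by blast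
  have "AE x in leb R. v x = p x" using u(2) assms(3) by eventually_elim simp
  then have "(H2_norm R v)\<^sup>2 = (H2_norm R u)\<^sup>2"
    using H2_repD(6)[OF assms(1) u(1)] u(2) by simp
  then show ?thesis using power2_eq_imp_eq H2_norm_nonneg by blast
qed

lemma H2_norm_scale:
  assumes "R > 0" "u \<in> H2 R"
  shows "H2_norm R (\<lambda>x. k * u x) = \<bar>k\<bar> * H2_norm R u"
proof -
  obtain p q w where u: "H2_rep R p q w" "AE x in leb R. u x = p x" using H2_imp_rep[OF assms] by blast
  have "H2_rep R (\<lambda>x. k * p x) (\<lambda>x. k * q x) (\<lambda>x. k * w x)"
    using H2_rep_add_scaled[OF H2_rep_0 u(1), of k] by simp
  moreover have "AE x in leb R. k * u x = k * p x" using u(2) by eventually_elim simp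
  ultimately have "(H2_norm R (\<lambda>x. k * u x))\<^sup>2 = k\<^sup>2 * (H2_norm R u)\<^sup>2"
    using H2_repD(6)[OF assms(1) u] H2_repD(6)[OF assms(1), of "\<lambda>x. k * p x" "\<lambda>x. k * q x" "\<lambda>x. k * w x" "\<lambda>x. k * u x"]
    by (simp add: power_mult_distrib distrib_left)
  then have "(H2_norm R (\<lambda>x. k * u x))\<^sup>2 = (\<bar>k\<bar> * H2_norm R u)\<^sup>2"
    by (simp add: power_mult_distrib)
  then show ?thesis by (rule power2_eq_imp_eq) (simp_all add: H2_norm_nonneg)
qed

lemma square_sum3_le: "(x + y + z)\<^sup>2 \<le> 3 * (x\<^sup>2 + y\<^sup>2 + z\<^sup>2)" for x y z :: real
proof -
  have "3 * (x\<^sup>2 + y\<^sup>2 + z\<^sup>2) - (x + y + z)\<^sup>2 = (x - y)\<^sup>2 + (y - z)\<^sup>2 + (x - z)\<^sup>2"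
    by (simp add: power2_eq_square algebra_simps)
  then show ?thesis by (smt (verit) zero_le_power2)
qed

lemma L2_sum3:
  assumes "f \<in> L2 R" "g \<in> L2 R" "h \<in> L2 R"
  shows "(\<lambda>x. f x + g x + h x) \<in> L2 R"
    and "(LINT x|leb R. (f x + g x + h x)\<^sup>2)
      \<le> 3 * ((LINT x|leb R. (f x)\<^sup>2) + (LINT x|leb R. (g x)\<^sup>2) + (LINT x|leb R. (h x)\<^sup>2))"
proof -
  show L: "(\<lambda>x. f x + g x + h x) \<in> L2 R"
    using L2_add_scaled[OF L2_add_scaled[OF assms(1,2), of 1] assms(3), of 1] by simp
  have i: "integrable (leb R) (\<lambda>x. 3 * ((f x)\<^sup>2 + (g x)\<^sup>2 + (h x)\<^sup>2))"
    using assms[THEN L2_square_integrable] by simp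
  have "(LINT x|leb R. (f x + g x + h x)\<^sup>2) \<le> (LINT x|leb R. 3 * ((f x)\<^sup>2 + (g x)\<^sup>2 + (h x)\<^sup>2))"
    using L2_square_integrable[OF L] i square_sum3_le by (intro integral_mono) auto
  then show "(LINT x|leb R. (f x + g x + h x)\<^sup>2)
      \<le> 3 * ((LINT x|leb R. (f x)\<^sup>2) + (LINT x|leb R. (g x)\<^sup>2) + (LINT x|leb R. (h x)\<^sup>2))"
    using assms[THEN L2_square_integrable] by simp
qed

lemma AE_leb_leI: "(\<And>x. x \<in> {-R..R} \<Longrightarrow> P x) \<Longrightarrow> AE x in leb R. P x"
  by (intro AE_I2) auto

text \<open>Since 1 / 0 = 0 here, boundedness of 1 / a does not exclude zeros of a;
  \<open>a_nz\<close> does.\<close>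

locale bvp =
  fixes R \<gamma> :: real and a b c g1 g2 :: "real \<Rightarrow> real"
  assumes R_pos: "R > 0" and \<gamma>_pos: "\<gamma> > 0"
    and a: "a \<in> Linf R" and a_nz: "AE x in leb R. a x \<noteq> 0" and inv_a: "(\<lambda>x. 1 / a x) \<in> Linf R"
    and b: "b \<in> L2 R" and c: "c \<in> L2 R"
begin

text \<open>The operator, the boundary operator and the homogeneous loss are restated for triples,
  where they are linear, respectively quadratic, at every point; \<open>Lop\<close> is so only up to
  the choice made in \<open>wderiv\<close>.\<close>

definition op_rep :: "(real \<Rightarrow> real) \<Rightarrow> (real \<Rightarrow> real) \<Rightarrow> (real \<Rightarrow> real) \<Rightarrow> real \<Rightarrow> real" where
  "op_rep p q w x = a x * w x + b x * q x + c x * p x"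

definition bd_rep :: "(real \<Rightarrow> real) \<Rightarrow> (real \<Rightarrow> real) \<Rightarrow> real \<Rightarrow> real" where
  "bd_rep p q y = g1 y * q y + g2 y * p y"

definition energy :: "(real \<Rightarrow> real) \<Rightarrow> (real \<Rightarrow> real) \<Rightarrow> (real \<Rightarrow> real) \<Rightarrow> real" where
  "energy p q w = (LINT x|leb R. (op_rep p q w x)\<^sup>2) + \<gamma> * ((bd_rep p q (-R))\<^sup>2 + (bd_rep p q R)\<^sup>2)"

abbreviation Z where "Z \<equiv> bvp_kernel R a b c g1 g2"
abbreviation E where "E \<equiv> loss R \<gamma> a b c g1 g2 (\<lambda>_. 0) (\<lambda>_. 0)"

text \<open>Each product pairs an L^2 factor with a bounded one: w is in L^2 and a bounded, whereas
  b and c are in L^2 and therefore need q and p in the supremum norm.\<close>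

lemma op_rep_L2:
  assumes "w \<in> L2 R" "continuous_on {-R..R} p" "continuous_on {-R..R} q"
    and M: "AE x in leb R. \<bar>a x\<bar> \<le> M" and S: "\<And>x. x \<in> {-R..R} \<Longrightarrow> \<bar>p x\<bar> \<le> S" "\<And>x. x \<in> {-R..R} \<Longrightarrow> \<bar>q x\<bar> \<le> S"
  shows "op_rep p q w \<in> L2 R"
    and "(LINT x|leb R. (op_rep p q w x)\<^sup>2) \<le> 3 * (M\<^sup>2 * (LINT x|leb R. (w x)\<^sup>2)
       + S\<^sup>2 * (LINT x|leb R. (b x)\<^sup>2) + S\<^sup>2 * (LINT x|leb R. (c x)\<^sup>2))"
proof -
  have am: "a \<in> borel_measurable (leb R)" using a by (simp add: Linf_def)
  note 1 = L2_mult_bounded[OF assms(1) am M]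
  have ae: "AE x in leb R. \<bar>p x\<bar> \<le> S" "AE x in leb R. \<bar>q x\<bar> \<le> S"
    using S by (auto intro!: AE_leb_leI)
  note 2 = L2_mult_bounded[OF b borel_measurable_leb_Icc[OF assms(3)] ae(2)]
  note 3 = L2_mult_bounded[OF c borel_measurable_leb_Icc[OF assms(2)] ae(1)]
  have eq: "op_rep p q w = (\<lambda>x. w x * a x + b x * q x + c x * p x)"
    by (auto simp: op_rep_def)
  show "op_rep p q w \<in> L2 R" unfolding eq by (intro L2_sum3 1 2 3)
  show "(LINT x|leb R. (op_rep p q w x)\<^sup>2) \<le> 3 * (M\<^sup>2 * (LINT x|leb R. (w x)\<^sup>2)
       + S\<^sup>2 * (LINT x|leb R. (b x)\<^sup>2) + S\<^sup>2 * (LINT x|leb R. (c x)\<^sup>2))"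
    unfolding eq by (rule order_trans[OF L2_sum3(2)[OF 1(1) 2(1) 3(1)]])
      (intro mult_left_mono add_mono 1(2) 2(2) 3(2), simp)
qed

lemma op_rep_in_L2:
  assumes "H2_rep R p q w" shows "op_rep p q w \<in> L2 R"
proof -
  note P = H2_rep_props[OF assms]
  obtain M where M: "AE x in leb R. \<bar>a x\<bar> \<le> M" using a by (auto simp: Linf_def)
  obtain S where "\<And>x. x \<in> {-R..R} \<Longrightarrow> \<bar>p x\<bar> \<le> S" using continuous_on_bounded_Om[OF P(1)] by blast
  moreover obtain T where "\<And>x. x \<in> {-R..R} \<Longrightarrow> \<bar>q x\<bar> \<le> T" using continuous_on_bounded_Om[OF P(2)] by blast
  ultimately show ?thesis
    by (intro op_rep_L2(1)[OF P(5,1,2) M, of "max S T"]) (auto simp: le_max_iff_disj)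
qed

lemma Lop_rep:
  assumes "H2_rep R p q w" "AE x in leb R. u x = p x"
  shows "AE x in leb R. Lop R a b c u x = op_rep p q w x"
  using H2_repD(2,3)[OF R_pos assms] assms(2) by eventually_elim (simp add: Lop_def op_rep_def)

lemma Bop_rep:
  assumes "H2_rep R p q w" "AE x in leb R. u x = p x" "y \<in> {-R, R}"
  shows "Bop R g1 g2 u y = bd_rep p q y"
  using H2_repD(4,5)[OF R_pos assms(1,2), of y] assms(3) R_pos by (auto simp: Bop_def bd_rep_def)

lemma op_rep_add_scaled:
  "op_rep (\<lambda>x. p x + k * p' x) (\<lambda>x. q x + k * q' x) (\<lambda>x. w x + k * w' x) x = op_rep p q w x + k * op_rep p' q' w' x"
  by (simp add: op_rep_def algebra_simps)

lemma bd_rep_add_scaled: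
  "bd_rep (\<lambda>x. p x + k * p' x) (\<lambda>x. q x + k * q' x) y = bd_rep p q y + k * bd_rep p' q' y"
  by (simp add: bd_rep_def algebra_simps)

lemma bd_norm_square: "(bd_norm R h)\<^sup>2 = (h (-R))\<^sup>2 + (h R)\<^sup>2"
  by (simp add: bd_norm_def)

text \<open>The factor k serves three purposes: k = 1 evaluates \<open>E\<close>, k = -1 expresses
  the residual of v through u - v for a solution u, and general k gives quadratic
  homogeneity.\<close>

lemma loss_rep:
  assumes "H2_rep R p q w" "AE x in leb R. Lop R a b c u x - f x = k * op_rep p q w x"
    and "\<And>y. y \<in> {-R, R} \<Longrightarrow> Bop R g1 g2 u y - g y = k * bd_rep p q y"
  shows "loss R \<gamma> a b c g1 g2 f g u = k\<^sup>2 * energy p q w"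
proof -
  have "(LINT x|leb R. (Lop R a b c u x - f x)\<^sup>2) = (LINT x|leb R. (k * op_rep p q w x)\<^sup>2)"
    by (rule L2_AE_cong(2)[OF L2_cmult[OF op_rep_in_L2[OF assms(1)]] assms(2)])
  moreover have "Bop R g1 g2 u R - g R = k * bd_rep p q R" "Bop R g1 g2 u (-R) - g (-R) = k * bd_rep p q (-R)"
    using assms(3) by simp_all
  ultimately show ?thesis
    by (simp add: loss_def L2_norm_square bd_norm_square energy_def power_mult_distrib algebra_simps)
qed

lemma E_rep:
  assumes "H2_rep R p q w" "AE x in leb R. u x = p x"
  shows "E u = energy p q w"
  using loss_rep[OF assms(1), of u "\<lambda>_. 0" 1 "\<lambda>_. 0"] Lop_rep[OF assms] Bop_rep[OF assms] by simp

lemma kernel_iff: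
  assumes "H2_rep R p q w" "AE x in leb R. u x = p x"
  shows "u \<in> Z \<longleftrightarrow> (AE x in leb R. op_rep p q w x = 0) \<and> bd_rep p q (-R) = 0 \<and> bd_rep p q R = 0"
proof -
  have "(AE x in leb R. Lop R a b c u x = 0) \<longleftrightarrow> (AE x in leb R. op_rep p q w x = 0)"
  proof
    assume "AE x in leb R. Lop R a b c u x = 0"
    with Lop_rep[OF assms] show "AE x in leb R. op_rep p q w x = 0" by eventually_elim simp
  next
    assume "AE x in leb R. op_rep p q w x = 0"
    with Lop_rep[OF assms] show "AE x in leb R. Lop R a b c u x = 0" by eventually_elim simp
  qed
  then show ?thesis
    using H2_repD(1)[OF R_pos assms] Bop_rep[OF assms] by (simp add: bvp_kernel_def bvp_solution_def)
qed

lemma kernel_H2: "z \<in> Z \<Longrightarrow> z \<in> H2 R"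
  by (simp add: bvp_kernel_def bvp_solution_def)

lemma kernel_0: "(\<lambda>x. 0) \<in> Z"
  using kernel_iff[OF H2_rep_0, of "\<lambda>x. 0"] by (simp add: op_rep_def bd_rep_def)

lemma kernel_add_scaled:
  assumes "z \<in> Z" "z' \<in> Z" shows "(\<lambda>x. z x + k * z' x) \<in> Z"
proof -
  obtain p q w where u: "H2_rep R p q w" "AE x in leb R. z x = p x"
    using H2_imp_rep[OF R_pos kernel_H2[OF assms(1)]] by blast
  obtain p' q' w' where v: "H2_rep R p' q' w'" "AE x in leb R. z' x = p' x"
    using H2_imp_rep[OF R_pos kernel_H2[OF assms(2)]] by blast
  have ae: "AE x in leb R. z x + k * z' x = p x + k * p' x"
    using u(2) v(2) by eventually_elim simp
  have "AE x in leb R. op_rep p q w x = 0" "AE x in leb R. op_rep p' q' w' x = 0"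
    using assms kernel_iff[OF u] kernel_iff[OF v] by auto
  then have "AE x in leb R. op_rep p q w x + k * op_rep p' q' w' x = 0"
    by eventually_elim simp
  then show ?thesis
    using assms kernel_iff[OF u] kernel_iff[OF v] kernel_iff[OF H2_rep_add_scaled[OF u(1) v(1)] ae]
    by (simp add: op_rep_add_scaled bd_rep_add_scaled)
qed

lemma E_add_kernel_scale:
  assumes "u \<in> H2 R" "z \<in> Z"
  shows "E (\<lambda>x. k * (u x + z x)) = k\<^sup>2 * E u"
proof -
  obtain p q w where u: "H2_rep R p q w" "AE x in leb R. u x = p x"
    using H2_imp_rep[OF R_pos assms(1)] by blast
  obtain p' q' w' where v: "H2_rep R p' q' w'" "AE x in leb R. z x = p' x"
    using H2_imp_rep[OF R_pos kernel_H2[OF assms(2)]] by blast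
  have rep: "H2_rep R (\<lambda>x. 0 + k * (p x + 1 * p' x)) (\<lambda>x. 0 + k * (q x + 1 * q' x)) (\<lambda>x. 0 + k * (w x + 1 * w' x))"
    by (rule H2_rep_add_scaled[OF H2_rep_0 H2_rep_add_scaled[OF u(1) v(1)]])
  have ae: "AE x in leb R. k * (u x + z x) = 0 + k * (p x + 1 * p' x)"
    using u(2) v(2) by eventually_elim simp
  have z: "AE x in leb R. op_rep p' q' w' x = 0" "bd_rep p' q' (-R) = 0" "bd_rep p' q' R = 0"
    using assms(2) kernel_iff[OF v] by auto
  have "AE x in leb R. Lop R a b c (\<lambda>x. k * (u x + z x)) x = k * op_rep p q w x"
    using Lop_rep[OF rep ae] z(1)
    by eventually_elim (simp add: op_rep_def algebra_simps, metis (no_types, lifting) distrib_left mult_zero_right add.assoc)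
  moreover have "Bop R g1 g2 (\<lambda>x. k * (u x + z x)) y = k * bd_rep p q y" if "y \<in> {-R, R}" for y
    using Bop_rep[OF rep ae that] z(2,3) that unfolding bd_rep_add_scaled by (auto simp: bd_rep_def)
  ultimately have "E (\<lambda>x. k * (u x + z x)) = k\<^sup>2 * energy p q w"
    by (intro loss_rep[OF u(1)]) auto
  then show ?thesis using E_rep[OF u] by simp
qed

lemma loss_eq_E:
  assumes u: "bvp_solution R a b c g1 g2 f g u" and v: "v \<in> H2 R"
  shows "loss R \<gamma> a b c g1 g2 f g v = E (\<lambda>x. u x + (-1) * v x)"
proof -
  have "u \<in> H2 R" and sol: "AE x in leb R. Lop R a b c u x = f x" "\<And>y. y \<in> {-R, R} \<Longrightarrow> Bop R g1 g2 u y = g y"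
    using u by (auto simp: bvp_solution_def)
  then obtain p q w where u: "H2_rep R p q w" "AE x in leb R. u x = p x"
    using H2_imp_rep[OF R_pos] by blast
  obtain p' q' w' where v: "H2_rep R p' q' w'" "AE x in leb R. v x = p' x"
    using H2_imp_rep[OF R_pos v] by blast
  note rep = H2_rep_add_scaled[OF u(1) v(1), of "-1"]
  have ae: "AE x in leb R. u x + (-1) * v x = p x + (-1) * p' x"
    using u(2) v(2) by eventually_elim simp
  have "loss R \<gamma> a b c g1 g2 f g v = (-1)\<^sup>2 * energy (\<lambda>x. p x + (-1) * p' x) (\<lambda>x. q x + (-1) * q' x) (\<lambda>x. w x + (-1) * w' x)"
  proof (rule loss_rep[OF rep])
    show "AE x in leb R. Lop R a b c v x - f x = -1 * op_rep (\<lambda>x. p x + (-1) * p' x) (\<lambda>x. q x + (-1) * q' x) (\<lambda>x. w x + (-1) * w' x) x"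
      using Lop_rep[OF u] Lop_rep[OF v] sol(1) unfolding op_rep_add_scaled by eventually_elim simp
    show "Bop R g1 g2 v y - g y = -1 * bd_rep (\<lambda>x. p x + (-1) * p' x) (\<lambda>x. q x + (-1) * q' x) y" if "y \<in> {-R, R}" for y
      using Bop_rep[OF u that] Bop_rep[OF v that] sol(2)[OF that] unfolding bd_rep_add_scaled by simp
  qed
  then show ?thesis using E_rep[OF rep ae] by simp
qed

lemma E_nonneg: "0 \<le> E u"
  using \<gamma>_pos by (simp add: loss_def)

lemma rep_sup_bound:
  assumes rep: "H2_rep R p q w" and N: "(LINT x|leb R. (p x)\<^sup>2) + (LINT x|leb R. (q x)\<^sup>2) + (LINT x|leb R. (w x)\<^sup>2) = N"
    and x: "x \<in> {-R..R}"
  shows "(p x)\<^sup>2 \<le> (1 / R + 4 * R) * N" "(q x)\<^sup>2 \<le> (1 / R + 4 * R) * N"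
proof -
  note P = H2_rep_props[OF rep]
  have nn: "0 \<le> (LINT x|leb R. (p x)\<^sup>2)" "0 \<le> (LINT x|leb R. (q x)\<^sup>2)" "0 \<le> (LINT x|leb R. (w x)\<^sup>2)"
    by (simp_all add: integral_nonneg_AE)
  have le: "(1 / R) * s + (4 * R) * t \<le> (1 / R + 4 * R) * N" if "s \<le> N" "t \<le> N" for s t
    unfolding distrib_right using that R_pos by (intro add_mono mult_left_mono) auto
  have "(p x)\<^sup>2 \<le> (1 / R) * (LINT t|leb R. (p t)\<^sup>2) + (4 * R) * (LINT t|leb R. (q t)\<^sup>2)"
    using rep unfolding H2_rep_def by (intro sup_le_L2_deriv[OF R_pos P(4) _ x]) blast
  also have "\<dots> \<le> (1 / R + 4 * R) * N" using nn N by (intro le) linarith+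
  finally show "(p x)\<^sup>2 \<le> (1 / R + 4 * R) * N" .
  have "(q x)\<^sup>2 \<le> (1 / R) * (LINT t|leb R. (q t)\<^sup>2) + (4 * R) * (LINT t|leb R. (w t)\<^sup>2)"
    using rep unfolding H2_rep_def by (intro sup_le_L2_deriv[OF R_pos P(5) _ x]) blast
  also have "\<dots> \<le> (1 / R + 4 * R) * N" using nn N by (intro le) linarith+
  finally show "(q x)\<^sup>2 \<le> (1 / R + 4 * R) * N" .
qed

lemma E_le_H2_norm: "\<exists>C>0. \<forall>u\<in>H2 R. E u \<le> C * (H2_norm R u)\<^sup>2"
proof -
  obtain M where M: "AE x in leb R. \<bar>a x\<bar> \<le> M" using a by (auto simp: Linf_def)
  define T where "T = 1 / R + 4 * R"
  have T: "T > 0" using R_pos by (simp add: T_def add_pos_pos)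
  define B where "B = (LINT x|leb R. (b x)\<^sup>2) + (LINT x|leb R. (c x)\<^sup>2)"
  have B: "B \<ge> 0" by (simp add: B_def integral_nonneg_AE)
  define G where "G = (g1 (-R))\<^sup>2 + (g2 (-R))\<^sup>2 + (g1 R)\<^sup>2 + (g2 R)\<^sup>2"
  \<comment> \<open>T is the embedding constant of \<open>rep_sup_bound\<close>. The factors 3 and 2
    come from squaring a sum of three and of two terms; the summand 1 makes C positive in every
    case.\<close>
  define C where "C = 3 * (M\<^sup>2 + T * B) + \<gamma> * (2 * T * G) + 1"
  have "C > 0" unfolding C_def G_def using B T \<gamma>_pos by (intro add_nonneg_pos add_nonneg_nonneg mult_nonneg_nonneg) auto
  moreover have "E u \<le> C * (H2_norm R u)\<^sup>2" if "u \<in> H2 R" for u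
  proof -
    obtain p q w where u: "H2_rep R p q w" "AE x in leb R. u x = p x"
      using H2_imp_rep[OF R_pos \<open>u \<in> H2 R\<close>] by blast
    note P = H2_rep_props[OF u(1)]
    define N where "N = (H2_norm R u)\<^sup>2"
    have N: "(LINT x|leb R. (p x)\<^sup>2) + (LINT x|leb R. (q x)\<^sup>2) + (LINT x|leb R. (w x)\<^sup>2) = N"
      using H2_repD(6)[OF R_pos u] by (simp add: N_def)
    have N0: "N \<ge> 0" by (simp add: N_def)
    have S: "\<bar>p x\<bar> \<le> sqrt (T * N)" "\<bar>q x\<bar> \<le> sqrt (T * N)" if "x \<in> {-R..R}" for x
      using rep_sup_bound[OF u(1) N that] by (simp_all add: T_def real_le_rsqrt)
    have sq: "(sqrt (T * N))\<^sup>2 = T * N" using T N0 by simp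
    have "(LINT x|leb R. (w x)\<^sup>2) \<le> N"
    proof -
      have "0 \<le> (LINT x|leb R. (p x)\<^sup>2)" "0 \<le> (LINT x|leb R. (q x)\<^sup>2)"
        by (simp_all add: integral_nonneg_AE)
      then show ?thesis using N by linarith
    qed
    then have "M\<^sup>2 * (LINT x|leb R. (w x)\<^sup>2) \<le> M\<^sup>2 * N" by (intro mult_left_mono) auto
    then have 1: "(LINT x|leb R. (op_rep p q w x)\<^sup>2) \<le> 3 * (M\<^sup>2 + T * B) * N"
      using op_rep_L2(2)[OF P(5,1,2) M S] unfolding sq B_def by (simp add: algebra_simps)
    have bd: "(bd_rep p q y)\<^sup>2 \<le> 2 * T * N * ((g1 y)\<^sup>2 + (g2 y)\<^sup>2)" if "y \<in> {-R..R}" for y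
    proof -
      have "(bd_rep p q y)\<^sup>2 \<le> 2 * ((g1 y * q y)\<^sup>2 + (g2 y * p y)\<^sup>2)"
        using zero_le_power2[of "g1 y * q y - g2 y * p y"] by (simp add: bd_rep_def power2_eq_square algebra_simps)
      also have "\<dots> \<le> 2 * ((g1 y)\<^sup>2 * (T * N) + (g2 y)\<^sup>2 * (T * N))"
        using rep_sup_bound[OF u(1) N that] unfolding power_mult_distrib T_def
        by (intro mult_left_mono add_mono) auto
      finally show ?thesis by (simp add: algebra_simps)
    qed
    have "(bd_rep p q (-R))\<^sup>2 + (bd_rep p q R)\<^sup>2 \<le> 2 * T * G * N"
      using bd[of R] bd[of "-R"] R_pos by (simp add: G_def algebra_simps)
    then have "\<gamma> * ((bd_rep p q (-R))\<^sup>2 + (bd_rep p q R)\<^sup>2) \<le> \<gamma> * (2 * T * G * N)"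
      using \<gamma>_pos by (intro mult_left_mono) auto
    with 1 N0 show ?thesis unfolding E_rep[OF u] energy_def C_def N_def[symmetric] by (simp add: algebra_simps)
  qed
  ultimately show ?thesis by blast
qed

end

section \<open>Compactness and quasi-optimality\<close>

context bvp
begin

text \<open>Multiplication by \<open>1/a\<close> recovers the second derivative from the operator and the
  lower-order terms, so strong convergence of the latter upgrades to that of the second derivatives
  without completeness of \<open>L\<^sup>2\<close>.\<close>

lemma compactness:
  assumes y: "\<And>n. y n \<in> H2 R" "\<And>n. H2_norm R (y n) \<le> 2" and E0: "(\<lambda>n. E (y n)) \<longlonglongrightarrow> 0"
  obtains z n where "z \<in> Z" "H2_norm R (\<lambda>x. y n x + (-1) * z x) < 1"
proof -
  have "\<exists>p q w. H2_rep R p q w \<and> (AE x in leb R. y n x = p x)" for n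
    using H2_imp_rep[OF R_pos y(1)] by metis
  then obtain p q w where rep: "\<And>n. H2_rep R (p n) (q n) (w n)" "\<And>n. AE x in leb R. y n x = p n x"
    by metis
  have nn: "0 \<le> (LINT x|leb R. (f x)\<^sup>2)" for f :: "real \<Rightarrow> real" by (simp add: integral_nonneg_AE)
  have N: "(LINT x|leb R. (p n x)\<^sup>2) + (LINT x|leb R. (q n x)\<^sup>2) + (LINT x|leb R. (w n x)\<^sup>2) \<le> 4" for n
    using H2_repD(6)[OF R_pos rep(1)[of n] rep(2)[of n]] power_mono[OF y(2) H2_norm_nonneg, of n 2] by simp
  have q4: "(LINT x|leb R. (q n x)\<^sup>2) \<le> 4" and w4: "(LINT x|leb R. (w n x)\<^sup>2) \<le> 4" for n
    using N[of n] nn[of "p n"] nn[of "q n"] nn[of "w n"] by linarith+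
  \<comment> \<open>Pairing function and derivative lets a single application of Arzela--Ascoli
    produce a common subsequence.\<close>
  define F where "F = (\<lambda>n x. (p n x, q n x))"
  define S where "S = sqrt ((1 / R + 4 * R) * 4)"
  have T: "1 / R + 4 * R > 0" using R_pos by (simp add: add_pos_pos)
  have sup: "\<bar>p n x\<bar> \<le> S \<and> \<bar>q n x\<bar> \<le> S" if "x \<in> {-R..R}" for n x
  proof -
    have "(p n x)\<^sup>2 \<le> (1 / R + 4 * R) * 4" "(q n x)\<^sup>2 \<le> (1 / R + 4 * R) * 4"
      using rep_sup_bound[OF rep(1)[of n] refl that] mult_left_mono[OF N[of n] less_imp_le[OF T]]
      by linarith+
    then show ?thesis by (simp add: S_def real_le_rsqrt)
  qed
  have norm_F: "norm (F n x - F m x') \<le> \<bar>p n x - p m x'\<bar> + \<bar>q n x - q m x'\<bar>" for n m x x'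
    unfolding F_def using norm_Pair_le[of "p n x - p m x'" "q n x - q m x'"] by simp
  obtain G K where G: "continuous_on {-R..R} G" and K: "strict_mono (K :: nat \<Rightarrow> nat)"
    and lim: "\<And>e. 0 < e \<Longrightarrow> \<exists>N. \<forall>n x. n \<ge> N \<and> x \<in> {-R..R} \<longrightarrow> norm (F (K n) x - G x) < e"
  proof (rule Arzela_Ascoli[of "{-R..R}" F "2 * S"])
    show "norm (F n x) \<le> 2 * S" if "x \<in> {-R..R}" for n x
      using norm_Pair_le[of "p n x" "q n x"] sup[OF that, of n] by (simp add: F_def)
    show "\<exists>d>0. \<forall>n x'. x' \<in> {-R..R} \<and> norm (x - x') < d \<longrightarrow> norm (F n x - F n x') < e"
      if x: "x \<in> {-R..R}" and e: "e > 0" for x e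
    proof (intro exI[of _ "e\<^sup>2 / 16"] conjI allI impI)
      show "e\<^sup>2 / 16 > 0" using e by simp
      fix n x' assume x': "x' \<in> {-R..R} \<and> norm (x - x') < e\<^sup>2 / 16"
      \<comment> \<open>Squared increments are at most 4 times the distance, hence below 4 e^2/16 =
        (e/2)^2; the 4 is the square of the norm bound 2.\<close>
      have step: "\<bar>h x - h x'\<bar> < e / 2" if k: "k \<in> L2 R" "(LINT t|leb R. (k t)\<^sup>2) \<le> 4"
        and h: "\<forall>x\<in>{-R..R}. h x = h (-R) + prim R k x" for h k
      proof -
        have "h x - h x' = prim R k x - prim R k x'"
          using bspec[OF h x] bspec[OF h, of x'] x' by linarith
        then have "(h x - h x')\<^sup>2 \<le> \<bar>x - x'\<bar> * (LINT t|leb R. (k t)\<^sup>2)"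
          using prim_holder[OF k(1), of x x'] by simp
        also have "\<dots> \<le> \<bar>x - x'\<bar> * 4" using k(2) by (intro mult_left_mono) auto
        also have "\<dots> < (e / 2)\<^sup>2" using x' by (simp add: power_divide)
        finally have "\<bar>h x - h x'\<bar>\<^sup>2 < (e / 2)\<^sup>2" by simp
        then show ?thesis by (rule power_less_imp_less_base) (use e in simp)
      qed
      have "\<bar>p n x - p n x'\<bar> < e / 2"
        using rep(1)[of n] unfolding H2_rep_def
        by (intro step[OF H2_rep_props(4)[OF rep(1)] q4]) blast
      moreover have "\<bar>q n x - q n x'\<bar> < e / 2"
        using rep(1)[of n] unfolding H2_rep_def
        by (intro step[OF H2_rep_props(5)[OF rep(1)] w4]) blast
      ultimately show "norm (F n x - F n x') < e"
        using norm_F[of n x n x'] by linarith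
    qed
  qed auto
  define p0 where "p0 = (\<lambda>x. fst (G x))"
  define q0 where "q0 = (\<lambda>x. snd (G x))"
  have pq0: "continuous_on {-R..R} p0" "continuous_on {-R..R} q0"
    unfolding p0_def q0_def by (intro continuous_intros G)+
  have Fc: "continuous_on {-R..R} (\<lambda>x. norm (F n x - G x))" for n
    unfolding F_def using H2_rep_props(1,2)[OF rep(1)] G by (intro continuous_intros)
  have "\<exists>m\<in>{-R..R}. \<forall>x\<in>{-R..R}. norm (F n x - G x) \<le> norm (F n m - G m)" for n
    using continuous_attains_sup[OF _ _ Fc] R_pos by auto
  then obtain m where m: "\<And>n. m n \<in> {-R..R}" "\<And>n x. x \<in> {-R..R} \<Longrightarrow> norm (F n x - G x) \<le> norm (F n (m n) - G (m n))"
    by metis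
  \<comment> \<open>The supremum norm of \<open>F (K n) - G\<close>, attained at
    \<open>m (K n)\<close>. As \<open>lim\<close> is uniform in x, it may be evaluated at this
    moving point.\<close>
  define \<delta> where "\<delta> = (\<lambda>n. norm (F (K n) (m (K n)) - G (m (K n))))"
  have \<delta>0: "\<delta> \<longlonglongrightarrow> 0"
  proof (rule LIMSEQ_I)
    fix e :: real assume "e > 0"
    from lim[OF this] show "\<exists>N. \<forall>n\<ge>N. norm (\<delta> n - 0) < e"
      using m(1) by (auto simp: \<delta>_def)
  qed
  have dp: "\<bar>p (K n) x + (-1) * p0 x\<bar> \<le> \<delta> n" and dq: "\<bar>q (K n) x + (-1) * q0 x\<bar> \<le> \<delta> n" if "x \<in> {-R..R}" for n x
  proof -
    have "norm (F (K n) x - G x) \<le> \<delta> n" unfolding \<delta>_def by (rule m(2)[OF that])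
    moreover have "\<bar>fst (F (K n) x - G x)\<bar> \<le> norm (F (K n) x - G x)"
      "\<bar>snd (F (K n) x - G x)\<bar> \<le> norm (F (K n) x - G x)"
      unfolding real_norm_def[symmetric] norm_conv_dist
      using dist_fst_le[of "F (K n) x - G x" 0] dist_snd_le[of "F (K n) x - G x" 0] by simp_all
    ultimately show "\<bar>p (K n) x + (-1) * p0 x\<bar> \<le> \<delta> n" "\<bar>q (K n) x + (-1) * q0 x\<bar> \<le> \<delta> n"
      by (simp_all add: F_def p0_def q0_def)
  qed
  have E_lim: "(\<lambda>n. E (y (K n))) \<longlonglongrightarrow> 0"
    using LIMSEQ_subseq_LIMSEQ[OF E0 K] by (simp add: o_def)
  \<comment> \<open>The equation a w + b q0 + c p0 = 0 solved for w: a limit in V can have no other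
    second derivative.\<close>
  define w0 where "w0 = (\<lambda>x. (b x * q0 x + c x * p0 x) * (- 1 / a x))"
  obtain M where M: "AE x in leb R. \<bar>1 / a x\<bar> \<le> M" using inv_a by (auto simp: Linf_def)
  then have M': "AE x in leb R. \<bar>- 1 / a x\<bar> \<le> M" by eventually_elim simp
  have ia: "(\<lambda>x. 1 / a x) \<in> borel_measurable (leb R)" using inv_a by (simp add: Linf_def)
  then have ia': "(\<lambda>x. - 1 / a x) \<in> borel_measurable (leb R)"
    using borel_measurable_uminus[OF ia] by simp
  have mult_L2: "(\<lambda>x. f x * h x) \<in> L2 R" if f: "f \<in> L2 R" and h: "continuous_on {-R..R} h" for f h
  proof -
    obtain C where "\<And>x. x \<in> {-R..R} \<Longrightarrow> \<bar>h x\<bar> \<le> C" using continuous_on_bounded_Om[OF h] by blast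
    then show ?thesis
      by (intro L2_mult_bounded(1)[OF f borel_measurable_leb_Icc[OF h]] AE_leb_leI)
  qed
  have w0: "w0 \<in> L2 R"
    unfolding w0_def
    using L2_mult_bounded(1)[OF L2_add_scaled[OF mult_L2[OF b pq0(2)] mult_L2[OF c pq0(1)], of 1] ia' M'] by simp
  define dw where "dw = (\<lambda>n x. w (K n) x + (-1) * w0 x)"
  have dw_L2: "dw n \<in> L2 R" for n
    unfolding dw_def by (intro L2_add_scaled H2_rep_props(5)[OF rep(1)] w0)
  have dw_bound: "(LINT x|leb R. (dw n x)\<^sup>2) \<le> M\<^sup>2 * (3 * (E (y (K n))
      + (\<delta> n)\<^sup>2 * (LINT x|leb R. (b x)\<^sup>2) + (\<delta> n)\<^sup>2 * (LINT x|leb R. (c x)\<^sup>2)))" for n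
  proof -
    define D where "D = op_rep (p (K n)) (q (K n)) (w (K n))"
    define dP where "dP = (\<lambda>x. p (K n) x + (-1) * p0 x)"
    define dQ where "dQ = (\<lambda>x. q (K n) x + (-1) * q0 x)"
    note P = H2_rep_props[OF rep(1)[of "K n"]]
    have D2: "D \<in> L2 R" unfolding D_def by (rule op_rep_in_L2[OF rep(1)])
    have D_le: "(LINT x|leb R. (D x)\<^sup>2) \<le> E (y (K n))"
      using \<gamma>_pos E_rep[OF rep(1)[of "K n"] rep(2)[of "K n"]] by (simp add: energy_def D_def)
    have cP: "continuous_on {-R..R} dP" "continuous_on {-R..R} dQ"
      unfolding dP_def dQ_def by (intro continuous_intros P pq0)+
    have aeP: "AE x in leb R. \<bar>dP x\<bar> \<le> \<delta> n" and aeQ: "AE x in leb R. \<bar>dQ x\<bar> \<le> \<delta> n"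
      unfolding dP_def dQ_def by (intro AE_leb_leI dp dq; assumption)+
    note bQ = L2_mult_bounded[OF b borel_measurable_leb_Icc[OF cP(2)] aeQ]
    note cP' = L2_mult_bounded[OF c borel_measurable_leb_Icc[OF cP(1)] aeP]
    \<comment> \<open>Removing b dQ and c dP from D replaces q and p by their limits: what remains
      is a w + b q0 + c p0, that is, a times dw. Hence dw is H / a.\<close>
    define H where "H = (\<lambda>x. D x + (-1) * (b x * dQ x) + (-1) * (c x * dP x))"
    note H = L2_sum3[OF D2 L2_cmult[OF bQ(1), of "-1"] L2_cmult[OF cP'(1), of "-1"], folded H_def]
    have "(LINT x|leb R. (H x)\<^sup>2) \<le> 3 * (E (y (K n)) + (\<delta> n)\<^sup>2 * (LINT x|leb R. (b x)\<^sup>2) + (\<delta> n)\<^sup>2 * (LINT x|leb R. (c x)\<^sup>2))"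
      using H(2) D_le bQ(2) cP'(2) by (simp add: H_def)
    then have "M\<^sup>2 * (LINT x|leb R. (H x)\<^sup>2) \<le> M\<^sup>2 * (3 * (E (y (K n)) + (\<delta> n)\<^sup>2 * (LINT x|leb R. (b x)\<^sup>2) + (\<delta> n)\<^sup>2 * (LINT x|leb R. (c x)\<^sup>2)))"
      by (intro mult_left_mono) auto
    moreover have "AE x in leb R. dw n x = H x * (1 / a x)"
      using a_nz by eventually_elim
        (simp add: dw_def w0_def H_def D_def dP_def dQ_def op_rep_def field_simps)
    then have "(LINT x|leb R. (dw n x)\<^sup>2) = (LINT x|leb R. (H x * (1 / a x))\<^sup>2)"
      by (rule L2_AE_cong(2)[OF L2_mult_bounded(1)[OF H(1) ia M]])
    ultimately show ?thesis using L2_mult_bounded(2)[OF H(1) ia M] by linarith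
  qed
  have dw0: "(\<lambda>n. LINT x|leb R. (dw n x)\<^sup>2) \<longlonglongrightarrow> 0"
  proof (rule tendsto_sandwich[OF _ _ tendsto_const])
    show "\<forall>\<^sub>F n in sequentially. 0 \<le> (LINT x|leb R. (dw n x)\<^sup>2)" using nn by simp
    show "\<forall>\<^sub>F n in sequentially. (LINT x|leb R. (dw n x)\<^sup>2) \<le> M\<^sup>2 * (3 * (E (y (K n))
      + (\<delta> n)\<^sup>2 * (LINT x|leb R. (b x)\<^sup>2) + (\<delta> n)\<^sup>2 * (LINT x|leb R. (c x)\<^sup>2)))" using dw_bound by simp
    have "(\<lambda>n. M\<^sup>2 * (3 * (E (y (K n)) + (\<delta> n)\<^sup>2 * (LINT x|leb R. (b x)\<^sup>2) + (\<delta> n)\<^sup>2 * (LINT x|leb R. (c x)\<^sup>2))))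
      \<longlonglongrightarrow> M\<^sup>2 * (3 * (0 + 0\<^sup>2 * (LINT x|leb R. (b x)\<^sup>2) + 0\<^sup>2 * (LINT x|leb R. (c x)\<^sup>2)))"
      by (intro tendsto_intros E_lim \<delta>0)
    then show "(\<lambda>n. M\<^sup>2 * (3 * (E (y (K n)) + (\<delta> n)\<^sup>2 * (LINT x|leb R. (b x)\<^sup>2) + (\<delta> n)\<^sup>2 * (LINT x|leb R. (c x)\<^sup>2))))
      \<longlonglongrightarrow> 0" by simp
  qed
  have small_L2: "(\<lambda>n. LINT x|leb R. (h n x)\<^sup>2) \<longlonglongrightarrow> 0"
    if h: "\<And>n. continuous_on {-R..R} (h n)" "\<And>n x. x \<in> {-R..R} \<Longrightarrow> \<bar>h n x\<bar> \<le> \<delta> n" for h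
  proof (rule tendsto_sandwich[OF _ _ tendsto_const])
    show "\<forall>\<^sub>F n in sequentially. 0 \<le> (LINT x|leb R. (h n x)\<^sup>2)" using nn by simp
    show "\<forall>\<^sub>F n in sequentially. (LINT x|leb R. (h n x)\<^sup>2) \<le> (\<delta> n)\<^sup>2 * (LINT x|leb R. 1\<^sup>2)"
      using L2_mult_bounded(2)[OF L2_const[of 1] borel_measurable_leb_Icc[OF h(1)] AE_leb_leI[OF h(2)]]
      by (intro always_eventually allI) simp
    have "(\<lambda>n. (\<delta> n)\<^sup>2 * (LINT x|leb R. 1\<^sup>2)) \<longlonglongrightarrow> 0\<^sup>2 * (LINT x|leb R. 1\<^sup>2)"
      by (intro tendsto_intros \<delta>0)
    then show "(\<lambda>n. (\<delta> n)\<^sup>2 * (LINT x|leb R. 1\<^sup>2)) \<longlonglongrightarrow> 0" by simp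
  qed
  have cdp: "continuous_on {-R..R} (\<lambda>x. p (K n) x + (-1) * p0 x)"
    and cdq: "continuous_on {-R..R} (\<lambda>x. q (K n) x + (-1) * q0 x)" for n
    by (intro continuous_intros H2_rep_props[OF rep(1)] pq0)+
  note dp0 = small_L2[OF cdp dp] and dq0 = small_L2[OF cdq dq]
  have pt: "(\<lambda>n. f (K n) x) \<longlonglongrightarrow> f0 x"
    if "\<And>n x. x \<in> {-R..R} \<Longrightarrow> \<bar>f (K n) x + (-1) * f0 x\<bar> \<le> \<delta> n" "x \<in> {-R..R}" for f f0 x
  proof -
    have "(\<lambda>n. f (K n) x - f0 x) \<longlonglongrightarrow> 0"
      by (rule Lim_null_comparison[OF _ \<delta>0]) (use that in auto)
    then show ?thesis by (rule LIM_zero_cancel)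
  qed
  \<comment> \<open>The integral relation survives the limit: the values of f converge uniformly,
    and \<open>prim_holder\<close> between -R, where primitives vanish, and x carries L^2
    convergence of k over to its primitive. It is applied with f = q, k = w and with f = p, k =
    q.\<close>
  have prim_lim: "f0 x = f0 (-R) + prim R k0 x"
    if x: "x \<in> {-R..R}" and k: "\<And>n. k n \<in> L2 R" "k0 \<in> L2 R" and d: "(\<lambda>n. LINT x|leb R. (k n x + (-1) * k0 x)\<^sup>2) \<longlonglongrightarrow> 0"
      and f: "\<And>n x. x \<in> {-R..R} \<Longrightarrow> \<bar>f (K n) x + (-1) * f0 x\<bar> \<le> \<delta> n"
      and eq: "\<And>n. \<forall>x\<in>{-R..R}. f (K n) x = f (K n) (-R) + prim R (k n) x" for x k k0 f f0
  proof -
    have "(\<lambda>n. (prim R (k n) x - prim R k0 x)\<^sup>2) \<longlonglongrightarrow> 0"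
    proof (rule tendsto_sandwich[OF _ _ tendsto_const])
      show "\<forall>\<^sub>F n in sequentially. 0 \<le> (prim R (k n) x - prim R k0 x)\<^sup>2" by simp
      have "(prim R (k n) x - prim R k0 x)\<^sup>2 \<le> \<bar>x - (-R)\<bar> * (LINT x|leb R. (k n x + (-1) * k0 x)\<^sup>2)" for n
        using prim_holder[OF L2_add_scaled[OF k(1)[of n] k(2), of "-1"], of x "-R"]
          prim_add_scaled[OF L2_integrable[OF k(1)[of n]] L2_integrable[OF k(2)], of "-1" x]
        unfolding prim_left by simp
      then show "\<forall>\<^sub>F n in sequentially. (prim R (k n) x - prim R k0 x)\<^sup>2 \<le> \<bar>x - (-R)\<bar> * (LINT x|leb R. (k n x + (-1) * k0 x)\<^sup>2)"
        by simp
      show "(\<lambda>n. \<bar>x - (-R)\<bar> * (LINT x|leb R. (k n x + (-1) * k0 x)\<^sup>2)) \<longlonglongrightarrow> 0"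
        using tendsto_mult_right_zero[OF d] .
    qed
    then have "(\<lambda>n. prim R (k n) x - prim R k0 x) \<longlonglongrightarrow> 0" by simp
    then have "(\<lambda>n. prim R (k n) x) \<longlonglongrightarrow> prim R k0 x" by (rule LIM_zero_cancel)
    moreover have "(\<lambda>n. f (K n) (-R)) \<longlonglongrightarrow> f0 (-R)" by (rule pt[of f f0, OF f]) (use R_pos in auto)
    ultimately have "(\<lambda>n. f (K n) (-R) + prim R (k n) x) \<longlonglongrightarrow> f0 (-R) + prim R k0 x"
      by (intro tendsto_add)
    moreover have "(\<lambda>n. f (K n) (-R) + prim R (k n) x) = (\<lambda>n. f (K n) x)"
      using bspec[OF eq x] by (intro ext) simp
    moreover have "(\<lambda>n. f (K n) x) \<longlonglongrightarrow> f0 x" by (rule pt[of f f0, OF f x])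
    ultimately show ?thesis using LIMSEQ_unique by metis
  qed
  have rep0: "H2_rep R p0 q0 w0"
    unfolding H2_rep_def
  proof (intro conjI ballI w0)
    fix x assume x: "x \<in> {-R..R}"
    show "q0 x = q0 (-R) + prim R w0 x"
    proof (rule prim_lim[OF x, where k = "\<lambda>n. w (K n)" and f = q])
      show "\<forall>x\<in>{-R..R}. q (K n) x = q (K n) (-R) + prim R (w (K n)) x" for n
        using rep(1)[of "K n"] unfolding H2_rep_def by blast
    qed (use dw0[unfolded dw_def] dq w0 H2_rep_props(5)[OF rep(1)] in auto)
    show "p0 x = p0 (-R) + prim R q0 x"
    proof (rule prim_lim[OF x, where k = "\<lambda>n. q (K n)" and f = p])
      show "\<forall>x\<in>{-R..R}. p (K n) x = p (K n) (-R) + prim R (q (K n)) x" for n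
        using rep(1)[of "K n"] unfolding H2_rep_def by blast
    qed (use dq0 dp L2_continuous[OF pq0(2)] H2_rep_props(4)[OF rep(1)] in auto)
  qed
  \<comment> \<open>The boundary terms are dominated by E, which tends to 0, and they converge to
    those of the limit because p and q converge at the end points; positivity of \<gamma> then gives
    the claim.\<close>
  have bd0: "bd_rep p0 q0 s = 0" if s: "s \<in> {-R, R}" for s
  proof -
    have sR: "s \<in> {-R..R}" using s R_pos by auto
    have "(\<lambda>n. \<gamma> * (bd_rep (p (K n)) (q (K n)) s)\<^sup>2) \<longlonglongrightarrow> 0"
    proof (rule tendsto_sandwich[OF _ _ tendsto_const E_lim])
      show "\<forall>\<^sub>F n in sequentially. 0 \<le> \<gamma> * (bd_rep (p (K n)) (q (K n)) s)\<^sup>2" using \<gamma>_pos by simp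
      have "\<gamma> * (bd_rep (p (K n)) (q (K n)) s)\<^sup>2 \<le> energy (p (K n)) (q (K n)) (w (K n))" for n
      proof -
        have "\<gamma> * (bd_rep (p (K n)) (q (K n)) s)\<^sup>2 \<le> \<gamma> * ((bd_rep (p (K n)) (q (K n)) (-R))\<^sup>2 + (bd_rep (p (K n)) (q (K n)) R)\<^sup>2)"
          using s \<gamma>_pos by (intro mult_left_mono) auto
        then show ?thesis using nn[of "op_rep (p (K n)) (q (K n)) (w (K n))"] unfolding energy_def by linarith
      qed
      then show "\<forall>\<^sub>F n in sequentially. \<gamma> * (bd_rep (p (K n)) (q (K n)) s)\<^sup>2 \<le> E (y (K n))"
        using E_rep[OF rep] by simp
    qed
    moreover have "(\<lambda>n. \<gamma> * (bd_rep (p (K n)) (q (K n)) s)\<^sup>2) \<longlonglongrightarrow> \<gamma> * (bd_rep p0 q0 s)\<^sup>2"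
      unfolding bd_rep_def by (intro tendsto_intros pt[of p p0, OF dp sR] pt[of q q0, OF dq sR])
    ultimately have "\<gamma> * (bd_rep p0 q0 s)\<^sup>2 = 0" using LIMSEQ_unique by blast
    then show ?thesis using \<gamma>_pos by simp
  qed
  have "AE x in leb R. op_rep p0 q0 w0 x = 0"
    using a_nz by eventually_elim (simp add: op_rep_def w0_def)
  then have Z: "p0 \<in> Z" using kernel_iff[OF rep0, of p0] bd0 by simp
  have "(H2_norm R (\<lambda>x. y (K n) x + (-1) * p0 x))\<^sup>2 =
      (LINT x|leb R. (p (K n) x + (-1) * p0 x)\<^sup>2) + (LINT x|leb R. (q (K n) x + (-1) * q0 x)\<^sup>2)
      + (LINT x|leb R. (dw n x)\<^sup>2)" for n
  proof -
    have "AE x in leb R. y (K n) x + (-1) * p0 x = p (K n) x + (-1) * p0 x"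
      using rep(2)[of "K n"] by eventually_elim simp
    from H2_repD(6)[OF R_pos H2_rep_add_scaled[OF rep(1) rep0] this] show ?thesis by (simp add: dw_def)
  qed
  moreover have "(\<lambda>n. (LINT x|leb R. (p (K n) x + (-1) * p0 x)\<^sup>2) + (LINT x|leb R. (q (K n) x + (-1) * q0 x)\<^sup>2)
      + (LINT x|leb R. (dw n x)\<^sup>2)) \<longlonglongrightarrow> 0 + 0 + 0"
    by (intro tendsto_add dp0 dq0 dw0)
  ultimately have "(\<lambda>n. (H2_norm R (\<lambda>x. y (K n) x + (-1) * p0 x))\<^sup>2) \<longlonglongrightarrow> 0" by simp
  then have "\<forall>\<^sub>F n in sequentially. (H2_norm R (\<lambda>x. y (K n) x + (-1) * p0 x))\<^sup>2 < 1"
    by (rule order_tendstoD) simp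
  then obtain n where "(H2_norm R (\<lambda>x. y (K n) x + (-1) * p0 x))\<^sup>2 < 1"
    by (auto simp: eventually_sequentially)
  then have "H2_norm R (\<lambda>x. y (K n) x + (-1) * p0 x) < 1"
    using power_less_imp_less_base[of _ 2 1] by simp
  with Z that show ?thesis by blast
qed

section \<open>The distance to V\<close>

definition kdist :: "(real \<Rightarrow> real) \<Rightarrow> real" where
  "kdist u = (INF z\<in>Z. H2_norm R (\<lambda>x. u x + z x))"

lemma kdist_le: "z \<in> Z \<Longrightarrow> kdist u \<le> H2_norm R (\<lambda>x. u x + z x)"
  unfolding kdist_def by (rule cINF_lower) (auto simp: H2_norm_nonneg intro!: bdd_belowI2[where m = 0])

lemma kdist_nonneg: "0 \<le> kdist u"
  unfolding kdist_def using kernel_0 by (intro cINF_greatest) (auto simp: H2_norm_nonneg)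

lemma kdist_le_E: "\<exists>C>0. \<forall>u\<in>H2 R. (kdist u)\<^sup>2 \<le> C * E u"
proof (rule ccontr)
  assume neg: "\<not> ?thesis"
  have "\<exists>u\<in>H2 R. (kdist u)\<^sup>2 > real (Suc n) * E u" for n
    using neg by (meson not_le of_nat_0_less_iff zero_less_Suc)
  then obtain v where v: "\<And>n. v n \<in> H2 R" "\<And>n. (kdist (v n))\<^sup>2 > real (Suc n) * E (v n)"
    by metis
  have pos: "kdist (v n) > 0" for n
  proof -
    have "(kdist (v n))\<^sup>2 > 0"
      using v(2)[of n] E_nonneg[of "v n"] by (smt (verit) mult_nonneg_nonneg of_nat_0_le_iff)
    then show ?thesis using kdist_nonneg[of "v n"] by (simp add: less_le)
  qed
  \<comment> \<open>Attainment of the infimum is avoided: being positive, it is approached within a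
    factor 2, which is the norm bound 2 in \<open>compactness\<close>.\<close>
  have "\<exists>z\<in>Z. H2_norm R (\<lambda>x. v n x + z x) < 2 * kdist (v n)" for n
  proof (rule ccontr)
    assume "\<not> ?thesis"
    then have "2 * kdist (v n) \<le> kdist (v n)"
      unfolding kdist_def[of "v n"] using kernel_0 by (intro cINF_greatest) (auto simp: kdist_def not_less)
    then show False using pos[of n] by simp
  qed
  then obtain z where z: "\<And>n. z n \<in> Z" "\<And>n. H2_norm R (\<lambda>x. v n x + z n x) < 2 * kdist (v n)"
    by metis
  have vz: "(\<lambda>x. v n x + z n x) \<in> H2 R" for n
    using H2_add_scaled[OF R_pos v(1)[of n] kernel_H2[OF z(1)[of n]], of 1] by simp
  \<comment> \<open>Shifting by V leaves E unchanged and dividing by the distance divides E by its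
    square, so E (y n) is at most 1/(n+1).\<close>
  define y where "y = (\<lambda>n x. (1 / kdist (v n)) * (v n x + z n x))"
  have yH: "y n \<in> H2 R" for n
    using H2_add_scaled[OF R_pos kernel_H2[OF kernel_0] vz[of n], of "1 / kdist (v n)"] by (simp add: y_def)
  have "H2_norm R (y n) \<le> 2" for n
    unfolding y_def H2_norm_scale[OF R_pos vz] using z(2)[of n] pos[of n] by (simp add: field_simps)
  moreover have "(\<lambda>n. E (y n)) \<longlonglongrightarrow> 0"
  proof (rule tendsto_sandwich[OF _ _ tendsto_const LIMSEQ_inverse_real_of_nat])
    have "E (y n) \<le> inverse (real (Suc n))" for n
    proof -
      have "E (y n) = E (v n) / (kdist (v n))\<^sup>2"
        unfolding y_def E_add_kernel_scale[OF v(1) z(1)] by (simp add: power_divide)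
      also have "\<dots> \<le> inverse (real (Suc n))"
        using v(2)[of n] pos[of n] by (simp add: field_simps del: of_nat_Suc)
      finally show ?thesis .
    qed
    then show "\<forall>\<^sub>F n in sequentially. E (y n) \<le> inverse (real (Suc n))" by simp
  qed (use E_nonneg in simp)
  ultimately obtain z' n where z': "z' \<in> Z" "H2_norm R (\<lambda>x. y n x + (-1) * z' x) < 1"
    using compactness[of y] yH by metis
  define d where "d = kdist (v n)"
  have d: "d > 0" using pos by (simp add: d_def)
  have yz: "(\<lambda>x. y n x + (-1) * z' x) \<in> H2 R" by (intro H2_add_scaled[OF R_pos] yH kernel_H2 z'(1))
  \<comment> \<open>Scaled back by d, the element of V close to \<open>y n\<close> turns z n - d z'
    into a competitor in the infimum defining d, with a value below d.\<close>
  have eq: "(\<lambda>x. v n x + (z n x + (- d) * z' x)) = (\<lambda>x. d * (y n x + (-1) * z' x))"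
    using d by (intro ext) (simp add: y_def d_def[symmetric] field_simps)
  have "d \<le> H2_norm R (\<lambda>x. v n x + (z n x + (- d) * z' x))"
    unfolding d_def by (intro kdist_le kernel_add_scaled z z')
  also have "\<dots> = d * H2_norm R (\<lambda>x. y n x + (-1) * z' x)"
    unfolding eq H2_norm_scale[OF R_pos yz] using d by simp
  also have "\<dots> < d" using z'(2) d by simp
  finally show False by simp
qed

text \<open>Stability, comparison of the losses and boundedness are chained on the level of squares,
  which makes the constant the square root of a product. It is quantified before the data and both
  functions, so it depends only on what the locale fixes.\<close>

lemma quasi_optimal:
  "\<exists>C>0. \<forall>f g u w wRF. bvp_solution R a b c g1 g2 f g u \<longrightarrow> w \<in> H2 R \<longrightarrow> wRF \<in> H2 R \<longrightarrow>
     loss R \<gamma> a b c g1 g2 f g wRF \<le> loss R \<gamma> a b c g1 g2 f g w \<longrightarrow>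
     kdist (\<lambda>x. u x - wRF x) \<le> C * H2_norm R (\<lambda>x. u x - w x)"
proof -
  obtain C1 where C1: "C1 > 0" "\<And>u. u \<in> H2 R \<Longrightarrow> E u \<le> C1 * (H2_norm R u)\<^sup>2" using E_le_H2_norm by blast
  obtain C2 where C2: "C2 > 0" "\<And>u. u \<in> H2 R \<Longrightarrow> (kdist u)\<^sup>2 \<le> C2 * E u" using kdist_le_E by blast
  have "kdist (\<lambda>x. u x - wRF x) \<le> sqrt (C2 * C1) * H2_norm R (\<lambda>x. u x - w x)"
    if u: "bvp_solution R a b c g1 g2 f g u" and w: "w \<in> H2 R" "wRF \<in> H2 R"
      and le: "loss R \<gamma> a b c g1 g2 f g wRF \<le> loss R \<gamma> a b c g1 g2 f g w" for f g u w wRF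
  proof -
    have uH: "u \<in> H2 R" using u by (simp add: bvp_solution_def)
    have H: "(\<lambda>x. u x - w x) \<in> H2 R" "(\<lambda>x. u x - wRF x) \<in> H2 R"
      using H2_add_scaled[OF R_pos uH w(1), of "-1"] H2_add_scaled[OF R_pos uH w(2), of "-1"] by simp_all
    have "(kdist (\<lambda>x. u x - wRF x))\<^sup>2 \<le> C2 * E (\<lambda>x. u x - wRF x)" by (rule C2(2)[OF H(2)])
    also have "\<dots> \<le> C2 * E (\<lambda>x. u x - w x)"
      using le loss_eq_E[OF u w(1)] loss_eq_E[OF u w(2)] C2(1) by (intro mult_left_mono) simp_all
    also have "\<dots> \<le> C2 * (C1 * (H2_norm R (\<lambda>x. u x - w x))\<^sup>2)"
      using C1(2)[OF H(1)] C2(1) by (intro mult_left_mono) auto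
    also have "\<dots> = (sqrt (C2 * C1) * H2_norm R (\<lambda>x. u x - w x))\<^sup>2"
      using C1(1) C2(1) by (simp add: power_mult_distrib)
    finally show ?thesis
      using C1(1) C2(1) by (rule_tac power2_le_imp_le) (auto simp: H2_norm_nonneg)
  qed
  moreover have "sqrt (C2 * C1) > 0" using C1(1) C2(1) by simp
  ultimately show ?thesis by blast
qed

text \<open>Adding an element of V to u gives another solution, so by uniqueness every element of V
  vanishes almost everywhere. The infimum therefore runs over equal numbers, although V may contain
  many functions.\<close>

lemma kdist_unique:
  assumes u: "bvp_solution R a b c g1 g2 f g u" and w: "w \<in> H2 R"
    and uniq: "\<forall>u'. bvp_solution R a b c g1 g2 f g u' \<longrightarrow> (AE x in leb R. u' x = u x)"
  shows "kdist (\<lambda>x. u x - w x) = H2_norm R (\<lambda>x. w x - u x)"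
proof -
  have uH: "u \<in> H2 R" using u by (simp add: bvp_solution_def)
  have H: "(\<lambda>x. u x - w x) \<in> H2 R"
    using H2_add_scaled[OF R_pos uH w, of "-1"] by simp
  have "H2_norm R (\<lambda>x. (u x - w x) + z x) = H2_norm R (\<lambda>x. w x - u x)" if z: "z \<in> Z" for z
  proof -
    have sum: "(\<lambda>x. u x + z x) \<in> H2 R" using H2_add_scaled[OF R_pos uH kernel_H2[OF z], of 1] by simp
    obtain p q w where ru: "H2_rep R p q w" "AE x in leb R. u x = p x"
      using H2_imp_rep[OF R_pos uH] by blast
    obtain p' q' w' where rz: "H2_rep R p' q' w'" "AE x in leb R. z x = p' x"
      using H2_imp_rep[OF R_pos kernel_H2[OF z]] by blast
    have ae: "AE x in leb R. u x + z x = p x + 1 * p' x"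
      using ru(2) rz(2) by eventually_elim simp
    note rep = H2_rep_add_scaled[OF ru(1) rz(1), of 1]
    have k: "AE x in leb R. op_rep p' q' w' x = 0" "bd_rep p' q' (-R) = 0" "bd_rep p' q' R = 0"
      using z kernel_iff[OF rz] by auto
    have f: "AE x in leb R. Lop R a b c u x = f x" and g: "\<And>y. y \<in> {-R, R} \<Longrightarrow> Bop R g1 g2 u y = g y"
      using u by (auto simp: bvp_solution_def)
    have "AE x in leb R. Lop R a b c (\<lambda>x. u x + z x) x = f x"
      using Lop_rep[OF rep ae] Lop_rep[OF ru] k(1) f
      unfolding op_rep_add_scaled by eventually_elim simp
    moreover have "Bop R g1 g2 (\<lambda>x. u x + z x) y = g y" if "y \<in> {-R, R}" for y
      using Bop_rep[OF rep ae that] Bop_rep[OF ru that] g[OF that] k(2,3) that unfolding bd_rep_add_scaled by auto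
    ultimately have "bvp_solution R a b c g1 g2 f g (\<lambda>x. u x + z x)"
      using sum by (simp add: bvp_solution_def)
    then have "AE x in leb R. u x + z x = u x" using uniq by blast
    then have "AE x in leb R. (u x - w0 x) + z x = u x - w0 x" for w0 by eventually_elim simp
    from H2_norm_AE_cong[OF R_pos H this] show ?thesis
      using H2_norm_scale[OF R_pos H, of "-1"] by simp
  qed
  then have "kdist (\<lambda>x. u x - w x) = (INF z\<in>Z. H2_norm R (\<lambda>x. w x - u x))"
    unfolding kdist_def by (intro INF_cong) auto
  then show ?thesis using kernel_0 by (simp add: cINF_const ex_in_conv[symmetric] exI[of _ "\<lambda>x. 0"])
qed

end

theorem theorem3p1:
  fixes R \<gamma> :: real and a b c g1 g2 :: "real \<Rightarrow> real"
  assumes "R > 0" and "\<gamma> > 0"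
    and "a \<in> Linf R"
    and "AE x in lebesgue_on (Om R). a x \<noteq> 0" and "(\<lambda>x. 1 / a x) \<in> Linf R"
    and "b \<in> L2 R" and "c \<in> L2 R"
  shows "\<exists>C>0. \<forall>f g u VRF uRF.
    f \<in> L2 R \<longrightarrow>
    bvp_solution R a b c g1 g2 f g u \<longrightarrow>
    rf_trial_space R VRF \<longrightarrow> VRF \<subseteq> H2 R \<longrightarrow>
    is_arg_min (loss R \<gamma> a b c g1 g2 f g) (\<lambda>w. w \<in> VRF) uRF \<longrightarrow>
      (INF v\<in>bvp_kernel R a b c g1 g2. H2_norm R (\<lambda>x. u x + v x - uRF x))
        \<le> C * (INF w\<in>VRF. H2_norm R (\<lambda>x. u x - w x)) \<and>
      ((\<forall>u'. bvp_solution R a b c g1 g2 f g u' \<longrightarrow> (AE x in lebesgue_on (Om R). u' x = u x)) \<longrightarrow>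
        H2_norm R (\<lambda>x. uRF x - u x) \<le> C * (INF w\<in>VRF. H2_norm R (\<lambda>x. w x - u x)))"
proof -
  interpret bvp R \<gamma> a b c g1 g2 by unfold_locales fact+
  obtain C where C: "C > 0" and opt: "\<And>f g u w wRF. bvp_solution R a b c g1 g2 f g u \<Longrightarrow> w \<in> H2 R \<Longrightarrow>
      wRF \<in> H2 R \<Longrightarrow> loss R \<gamma> a b c g1 g2 f g wRF \<le> loss R \<gamma> a b c g1 g2 f g w \<Longrightarrow>
      kdist (\<lambda>x. u x - wRF x) \<le> C * H2_norm R (\<lambda>x. u x - w x)"
    using quasi_optimal by blast
  show ?thesis
  proof (intro exI[of _ C] conjI C allI impI)
    fix f g u VRF uRF
    assume u: "bvp_solution R a b c g1 g2 f g u" and V: "VRF \<subseteq> H2 R"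
      and min: "is_arg_min (loss R \<gamma> a b c g1 g2 f g) (\<lambda>w. w \<in> VRF) uRF"
    have uRF: "uRF \<in> VRF" and le: "\<And>w. w \<in> VRF \<Longrightarrow> loss R \<gamma> a b c g1 g2 f g uRF \<le> loss R \<gamma> a b c g1 g2 f g w"
      using min by (auto simp: is_arg_min_def not_less)
    have uH: "u \<in> H2 R" using u by (simp add: bvp_solution_def)
    \<comment> \<open>Division by C makes the left side a lower bound for every competitor, so that
      the infimum can be taken; the trial space is nonempty as it contains uRF.\<close>
    have "kdist (\<lambda>x. u x - uRF x) / C \<le> (INF w\<in>VRF. H2_norm R (\<lambda>x. u x - w x))"
    proof (rule cINF_greatest)
      fix w assume "w \<in> VRF"
      then have "kdist (\<lambda>x. u x - uRF x) \<le> C * H2_norm R (\<lambda>x. u x - w x)"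
        using V uRF by (intro opt[OF u] le) auto
      then show "kdist (\<lambda>x. u x - uRF x) / C \<le> H2_norm R (\<lambda>x. u x - w x)"
        using C by (simp add: field_simps)
    qed (use uRF in auto)
    then have main: "kdist (\<lambda>x. u x - uRF x) \<le> C * (INF w\<in>VRF. H2_norm R (\<lambda>x. u x - w x))"
      using C by (simp add: field_simps)
    moreover have "(\<lambda>x. u x + v x - uRF x) = (\<lambda>x. (u x - uRF x) + v x)" for v by auto
    ultimately show "(INF v\<in>bvp_kernel R a b c g1 g2. H2_norm R (\<lambda>x. u x + v x - uRF x))
        \<le> C * (INF w\<in>VRF. H2_norm R (\<lambda>x. u x - w x))"
      by (simp add: kdist_def)
    assume uniq: "\<forall>u'. bvp_solution R a b c g1 g2 f g u' \<longrightarrow> (AE x in lebesgue_on (Om R). u' x = u x)"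
    have "H2_norm R (\<lambda>x. w x - u x) = H2_norm R (\<lambda>x. u x - w x)" if "w \<in> VRF" for w
    proof -
      have "(\<lambda>x. u x - w x) \<in> H2 R"
        using that V H2_add_scaled[OF R_pos uH, of w "-1"] by auto
      from H2_norm_scale[OF R_pos this, of "-1"] show ?thesis by simp
    qed
    then have "(INF w\<in>VRF. H2_norm R (\<lambda>x. w x - u x)) = (INF w\<in>VRF. H2_norm R (\<lambda>x. u x - w x))"
      by (intro INF_cong) auto
    then show "H2_norm R (\<lambda>x. uRF x - u x) \<le> C * (INF w\<in>VRF. H2_norm R (\<lambda>x. w x - u x))"
      using main kdist_unique[OF u _ uniq, of uRF] uRF V by auto
  qed
qed

end
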